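(* Let $X=(X,|\cdot|)$ be a Banach space, let $A\colon [0,\infty)\to \mathcal B(X)$ and $f\colon [0,\infty)\times X\to X$ be continuous, and let $\infty\ge p\ge q\ge 1$. Suppose that the linear equation $x'=A(t)x$, $t\ge 0$, admits an exponential dichotomy with constants $D,\lambda>0$, and that there exists $c\in [0,\frac{\lambda}{2D})$ such that \[ |f(t,v_1)-f(t,v_2)|\le c|v_1-v_2| \quad \text{for all } v_1,v_2\in X \text{ and } t\ge 0. \] Then the equation $x'=A(t)x+f(t,x)$, $t\ge 0$, admits $(L^p,L^q)$ Hyers-Ulam stability.
   Context: $\mathcal B(X)$ is the space of bounded linear operators on $X$ with the operator norm $\|\cdot\|$, and $\mathrm{Id}$ is the identity operator on $X$. $T(t,s)$, $t,s\ge 0$, denotes the evolution family associated to $x'=A(t)x$, i.e. $T(t,s)x(s)=x(t)$ for every solution $x$ of $x'=A(t)x$ on $[0,\infty)$ (and all $t,s\ge0$). Exponential dichotomy: $x'=A(t)x$, $t\ge 0$, admits an exponential dichotomy (with constants $D,\lambda>0$) if there exist a family of (bounded linear) projections $P(t)$, $t\ge 0$, on $X$ and constants $D,\lambda>0$ such that: (1) $T(t,s)P(s)=P(t)T(t,s)$ for $t,s\ge 0$; (2) $\|T(t,s)P(s)\|\le De^{-\lambda(t-s)}$ for $t\ge s\ge 0$; (3) $\|T(t,s)(\mathrm{Id}-P(s))\|\le De^{-\lambda(s-t)}$ for $0\le t\le s$. For $p\in[1,\infty)$, $L^p([0,\infty),X)$ is the space of Bochner measurable $x\colon[0,\infty)\to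 X$ with $\|x\|_{L^p([0,\infty),X)}:=\left(\int_0^\infty|x(t)|^p\,dt\right)^{1/p}<+\infty$; $L^\infty([0,\infty),X)$ is the space of Bochner measurable $x$ with $\|x\|_{L^\infty([0,\infty),X)}:=\operatorname{ess\,sup}_{t\ge 0}|x(t)|<+\infty$ (functions equal almost everywhere are identified). $(L^p,L^q)$ Hyers-Ulam stability, for $p,q\in[1,\infty]$: the equation $x'=A(t)x+f(t,x)$, $t\ge0$, admits $(L^p,L^q)$ Hyers-Ulam stability if there exists $L>0$ such that for each $\varepsilon>0$ and each continuously differentiable $y\colon[0,\infty)\to X$ satisfying $y'(\cdot)-A(\cdot)y(\cdot)-f(\cdot,y(\cdot))\in L^q([0,\infty),X)$ and $\|y'(\cdot)-A(\cdot)y(\cdot)-f(\cdot,y(\cdot))\|_{L^q([0,\infty),X)}\le\varepsilon$, there exists a solution $x\colon[0,\infty)\to X$ of $x'=A(t)x+f(t,x)$ such that $x-y\in L^p([0,\infty),X)$ and $\|x-y\|_{L^p([0,\infty),X)}\le L\varepsilon$. *)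

theory Defs
  imports "HOL-Analysis.Analysis" "HOL-Probability.Essential_Supremum"
begin

(* Functions on [0,\<infinity>) are total functions on the reals whose values at negative arguments are
   never used; derivatives at 0 are one-sided. *)

definition solves :: "(real \<Rightarrow> 'a::real_normed_vector \<Rightarrow> 'a) \<Rightarrow> (real \<Rightarrow> 'a) \<Rightarrow> bool" where
  "solves F x \<longleftrightarrow> (\<forall>t\<ge>0. (x has_vector_derivative F t (x t)) (at t within {0..}))"

(* When A is continuous on [0,\<infinity>), this determines T t s for all t, s \<ge> 0, since there is
   exactly one solution through every (s, v) with s \<ge> 0. *)
definition evolution_family ::
  "(real \<Rightarrow> 'a::banach \<Rightarrow>\<^sub>L 'a) \<Rightarrow> (real \<Rightarrow> real \<Rightarrow> 'a \<Rightarrow>\<^sub>L 'a) \<Rightarrow> bool" where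
  "evolution_family A T \<longleftrightarrow>
     (\<forall>x. solves (\<lambda>t v. A t v) x \<longrightarrow> (\<forall>t\<ge>0. \<forall>s\<ge>0. T t s (x s) = x t))"

definition exponential_dichotomy ::
  "(real \<Rightarrow> 'a::banach \<Rightarrow>\<^sub>L 'a) \<Rightarrow> real \<Rightarrow> real \<Rightarrow> bool" where
  "exponential_dichotomy A D l \<longleftrightarrow> D > 0 \<and> l > 0 \<and>
     (\<exists>T P. evolution_family A T \<and>
        (\<forall>t\<ge>0. P t o\<^sub>L P t = P t) \<and>
        (\<forall>t\<ge>0. \<forall>s\<ge>0. T t s o\<^sub>L P s = P t o\<^sub>L T t s) \<and>
        (\<forall>s\<ge>0. \<forall>t\<ge>s. norm (T t s o\<^sub>L P s) \<le> D * exp (- l * (t - s))) \<and>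
        (\<forall>t\<ge>0. \<forall>s\<ge>t. norm (T t s o\<^sub>L (id_blinfun - P s)) \<le> D * exp (- l * (s - t))))"

(* Almost everywhere limit of simple functions. For non-separable range this is stronger than
   Borel measurability, which is why borel_measurable is not used. *)
definition bochner_measurable :: "'b measure \<Rightarrow> ('b \<Rightarrow> 'a::real_normed_vector) \<Rightarrow> bool" where
  "bochner_measurable M x \<longleftrightarrow>
     (\<exists>s. (\<forall>n::nat. simple_function M (s n)) \<and> (AE t in M. (\<lambda>n. s n t) \<longlonglongrightarrow> x t))"

definition Lp_space :: "ennreal \<Rightarrow> (real \<Rightarrow> 'a::banach) set" where
  "Lp_space p = {x. bochner_measurable (lebesgue_on {0..}) x \<and>
     (if p = \<infinity> then esssup (lebesgue_on {0..}) (\<lambda>t. ennreal (norm (x t))) < \<infinity>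
      else (\<integral>\<^sup>+ t. ennreal (norm (x t) powr enn2real p) \<partial>lebesgue_on {0..}) < \<infinity>)}"

(* Only meaningful for members of Lp_space p: enn2real sends \<infinity> to 0. *)
definition Lp_norm :: "ennreal \<Rightarrow> (real \<Rightarrow> 'a::banach) \<Rightarrow> real" where
  "Lp_norm p x =
     (if p = \<infinity> then enn2real (esssup (lebesgue_on {0..}) (\<lambda>t. ennreal (norm (x t))))
      else enn2real (\<integral>\<^sup>+ t. ennreal (norm (x t) powr enn2real p) \<partial>lebesgue_on {0..})
             powr (1 / enn2real p))"

definition hyers_ulam_stable ::
  "ennreal \<Rightarrow> ennreal \<Rightarrow> (real \<Rightarrow> 'a::banach \<Rightarrow>\<^sub>L 'a) \<Rightarrow> (real \<Rightarrow> 'a \<Rightarrow> 'a) \<Rightarrow> bool" where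
  "hyers_ulam_stable p q A f \<longleftrightarrow>
     (\<exists>L>0. \<forall>\<epsilon>>0. \<forall>y y'.
        (\<forall>t\<ge>0. (y has_vector_derivative y' t) (at t within {0..})) \<and> continuous_on {0..} y' \<and>
        (\<lambda>t. y' t - A t (y t) - f t (y t)) \<in> Lp_space q \<and>
        Lp_norm q (\<lambda>t. y' t - A t (y t) - f t (y t)) \<le> \<epsilon> \<longrightarrow>
        (\<exists>x. solves (\<lambda>t v. A t v + f t v) x \<and>
             (\<lambda>t. x t - y t) \<in> Lp_space p \<and> Lp_norm p (\<lambda>t. x t - y t) \<le> L * \<epsilon>))"

end

theory Submission
  imports Defs
begin

text \<open>
  Write \<open>r = y' - A y - f(\<cdot>, y)\<close> for the residual and look for a solution \<open>x = y + w\<close>. Then \<open>w\<close>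
  has to solve \<open>w' = A w + (f(t, y + w) - f(t, y)) - r\<close>, a Lipschitz perturbation of the dichotomous
  linear equation that vanishes at \<open>w = 0\<close> up to the forcing \<open>r\<close>. Inverting \<open>w' - A w\<close> by the
  Green kernel \<open>G(t, s)\<close> of the dichotomy, for which \<open>|G(t, s)| \<le> D exp(-l|t - s|)\<close>, turns this into a
  fixed point problem \<open>w = G (F(w) - r)\<close>.

  The point is to choose where the fixed point is sought. A contraction in the sup norm would give a
  bounded \<open>w\<close> without any information on its \<open>L\<^sup>p\<close> norm. Here the contraction takes place
  among the functions dominated by a multiple of the weight
  \<open>\<psi>(t) = \<integral>\<^sub>0\<^sup>\<infinity> exp(-\<mu>|t - s|) |r(s)| ds\<close> with \<open>0 < \<mu> < l\<close>. It dominates the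
  inhomogeneous term, \<open>|G r| \<le> D \<psi>\<close>, since \<open>\<mu> < l\<close>. It varies slowly,
  \<open>\<psi>(s) \<le> exp(\<mu>|t - s|) \<psi>(t)\<close>, so that a function bounded by \<open>\<psi>\<close> is mapped by \<open>G\<close> to one
  bounded by \<open>2 D / (l - \<mu>) \<cdot> \<psi>\<close>. Hence the map contracts with factor \<open>\<rho> = 2 D c / (l - \<mu>)\<close>, and
  \<open>\<rho> < 1\<close> for small \<open>\<mu>\<close> exactly because \<open>c < l / (2 D)\<close>. The fixed point satisfies
  \<open>|w| \<le> D / (1 - \<rho>) \<cdot> \<psi>\<close> pointwise (lemma \<open>perturbed_equation_solution\<close>), which reduces the theorem to
  \<open>\<parallel>\<psi>\<parallel>\<^sub>p \<le> max(1, 2 / \<mu>) \<parallel>r\<parallel>\<^sub>q\<close> for \<open>q \<le> p\<close>, Young's inequality for convolution with the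
  exponential kernel (lemma \<open>Lp_norm_le_of_exp_potential_bound\<close>).

  A dichotomy only mentions the evolution family through the solutions of \<open>x' = A(t) x\<close>, so one also has
  to know that there are enough solutions: lemma \<open>fundamental_solution\<close> constructs an invertible
  operator-valued solution \<open>U\<close>, and lemma \<open>dichotomous_flow_of_exponential_dichotomy\<close> writes
  the two halves of the Green kernel as \<open>U(t) P U(s)\<inverse>\<close> and \<open>U(t) (Id - P) U(s)\<inverse>\<close> with the single
  projection \<open>P = P(0)\<close>. The equation for \<open>G h\<close> is then the product rule. Since \<open>X\<close> need not be
  separable, vector-valued integrals are taken in the sense of Henstock and Kurzweil over compact
  intervals, where the integrands are continuous; Lebesgue integration is applied to norms only.
\<close>

section \<open>Continuous functions on the half-line\<close>

lemma continuous_on_halfline: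
  fixes f :: "real \<Rightarrow> 'b::topological_space"
  assumes "\<And>b. 0 \<le> b \<Longrightarrow> continuous_on {0..b} f"
  shows "continuous_on {0..} f"
  unfolding continuous_on_eq_continuous_within
proof
  fix t :: real assume "t \<in> {0..}"
  then have t: "0 \<le> t" by simp
  have "continuous (at t within {0..t+1}) f"
    using assms[of "t+1"] t by (simp add: continuous_on_eq_continuous_within)
  moreover have "at t within {0..t+1} = at t within {0..}"
    by (rule at_within_nhd[of _ "{..<t+1}"]) auto
  ultimately show "continuous (at t within {0..}) f" by simp
qed

lemma integral_has_vector_derivative_halfline:
  fixes f :: "real \<Rightarrow> 'b::banach"
  assumes "continuous_on {0..} f" and "0 \<le> t"
  shows "((\<lambda>u. integral {0..u} f) has_vector_derivative f t) (at t within {0..})"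
proof -
  have "((\<lambda>u. integral {0..u} f) has_vector_derivative f t) (at t within {0..t+1})"
    using assms by (intro integral_has_vector_derivative) (auto intro: continuous_on_subset)
  moreover have "at t within {0..t+1} = at t within {0..}"
    by (rule at_within_nhd[of _ "{..<t+1}"]) auto
  ultimately show ?thesis by simp
qed

lemma continuous_on_halfline_of_derivative:
  assumes "\<And>t. 0 \<le> t \<Longrightarrow> (x has_vector_derivative x' t) (at t within {0..})"
  shows "continuous_on {0..} x"
  using assms by (auto simp: continuous_on_eq_continuous_within intro: has_vector_derivative_continuous)

lemma integrable_halfline:
  fixes f :: "real \<Rightarrow> 'b::banach"
  assumes "continuous_on {0..} f" and "0 \<le> a"
  shows "f integrable_on {a..b}"
  using assms by (intro integrable_continuous_real) (auto intro: continuous_on_subset)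

section \<open>A contraction principle with a weight\<close>

text \<open>
  Picard iteration from \<open>0\<close>, with all increments measured in units of \<open>\<psi>\<close>: they decay like
  \<open>K \<rho>\<^sup>n \<psi>\<close>, so the iterates converge uniformly on compact intervals and the bound on the limit is the
  geometric series. Working with inequalities instead of the norm \<open>sup |w| / \<psi>\<close> allows the weight to
  vanish. A fast growing weight gives global solutions of linear equations; an integrable one gives
  integrable fixed points.
\<close>
lemma weighted_contraction_fixpoint:
  fixes \<Phi> :: "(real \<Rightarrow> 'b::banach) \<Rightarrow> real \<Rightarrow> 'b" and \<psi> :: "real \<Rightarrow> real"
  assumes \<psi>: "continuous_on {0..} \<psi>" "\<And>t. 0 \<le> t \<Longrightarrow> 0 \<le> \<psi> t"
    and \<rho>: "0 \<le> \<rho>" "\<rho> < 1" and K: "0 \<le> K"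
    and cont: "\<And>w C. continuous_on {0..} w \<Longrightarrow> (\<And>t. 0 \<le> t \<Longrightarrow> norm (w t) \<le> C * \<psi> t)
      \<Longrightarrow> continuous_on {0..} (\<Phi> w)"
    and contr: "\<And>v w C d t. continuous_on {0..} v \<Longrightarrow> continuous_on {0..} w
      \<Longrightarrow> (\<And>t. 0 \<le> t \<Longrightarrow> norm (v t) \<le> C * \<psi> t) \<Longrightarrow> (\<And>t. 0 \<le> t \<Longrightarrow> norm (w t) \<le> C * \<psi> t)
      \<Longrightarrow> 0 \<le> d \<Longrightarrow> (\<And>t. 0 \<le> t \<Longrightarrow> norm (v t - w t) \<le> d * \<psi> t) \<Longrightarrow> 0 \<le> t
      \<Longrightarrow> norm (\<Phi> v t - \<Phi> w t) \<le> \<rho> * d * \<psi> t"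
    and zero: "\<And>t. 0 \<le> t \<Longrightarrow> norm (\<Phi> (\<lambda>_. 0) t) \<le> K * \<psi> t"
  obtains w where "continuous_on {0..} w" and "\<And>t. 0 \<le> t \<Longrightarrow> norm (w t) \<le> K / (1 - \<rho>) * \<psi> t"
    and "\<And>t. 0 \<le> t \<Longrightarrow> \<Phi> w t = w t"
proof -
  define W where "W n = (\<Phi> ^^ n) (\<lambda>_. 0)" for n
  define C where "C = K / (1 - \<rho>)"
  have W0: "W 0 = (\<lambda>_. 0)" and WS: "W (Suc n) = \<Phi> (W n)" for n by (simp_all add: W_def)
  have C: "0 \<le> C" "K + \<rho> * C = C" using \<rho> K by (auto simp: C_def field_simps)
  have W: "continuous_on {0..} (W n) \<and> (\<forall>t\<ge>0. norm (W n t) \<le> C * \<psi> t)" for n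
  proof (induction n)
    case 0
    then show ?case using C \<psi> by (simp add: W0)
  next
    case (Suc n)
    have "norm (W (Suc n) t) \<le> C * \<psi> t" if t: "0 \<le> t" for t
    proof -
      have "norm (\<Phi> (W n) t - \<Phi> (\<lambda>_. 0) t) \<le> \<rho> * C * \<psi> t"
        using Suc C \<psi> t by (intro contr[where C = C]) auto
      then have "norm (\<Phi> (W n) t) \<le> \<rho> * C * \<psi> t + K * \<psi> t"
        using zero[OF t] norm_triangle_sub[of "\<Phi> (W n) t" "\<Phi> (\<lambda>_. 0) t"] by linarith
      also have "\<dots> = C * \<psi> t" using C(2) by (metis add.commute distrib_right)
      finally show ?thesis by (simp add: WS)
    qed
    then show ?case using cont[of "W n" C] Suc by (auto simp: WS)
  qed
  have step: "norm (W (Suc n) t - W n t) \<le> K * \<rho> ^ n * \<psi> t" if "0 \<le> t" for n t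
    using that
  proof (induction n arbitrary: t)
    case 0
    then show ?case using zero[of t] by (simp add: W0 WS)
  next
    case (Suc n)
    have "norm (\<Phi> (W (Suc n)) t - \<Phi> (W n) t) \<le> \<rho> * (K * \<rho> ^ n) * \<psi> t"
      using Suc W \<rho> K by (intro contr[where C = C]) auto
    then show ?case by (simp add: WS mult_ac)
  qed
  define w where "w t = (\<Sum>i. W (Suc i) t - W i t)" for t
  have W_sum: "W n t = (\<Sum>i<n. W (Suc i) t - W i t)" for n t
    by (simp add: sum_lessThan_telescope[of "\<lambda>i. W i t"] W0)
  have geo: "summable (\<lambda>n. \<rho> ^ n)" using \<rho> by (simp add: summable_geometric)
  have unif: "uniform_limit {0..b} W w sequentially" if "0 \<le> b" for b
  proof -
    have "compact (\<psi> ` {0..b})"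
      by (intro compact_continuous_image continuous_on_subset[OF \<psi>(1)]) auto
    then obtain B where B: "\<And>t. t \<in> {0..b} \<Longrightarrow> norm (\<psi> t) \<le> B"
      by (metis bounded_iff compact_imp_bounded imageI)
    have "uniform_limit {0..b} (\<lambda>n t. \<Sum>i<n. W (Suc i) t - W i t)
      (\<lambda>t. \<Sum>i. W (Suc i) t - W i t) sequentially"
    proof (rule Weierstrass_m_test)
      show "norm (W (Suc n) t - W n t) \<le> K * \<rho> ^ n * B" if "t \<in> {0..b}" for n t
        using step[of t n] B[OF that] \<rho> K that
        by (smt (verit) atLeastAtMost_iff mult_left_mono mult_nonneg_nonneg real_norm_def zero_le_power)
      show "summable (\<lambda>n. K * \<rho> ^ n * B)" by (intro summable_mult summable_mult2 geo)
    qed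
    then show ?thesis by (simp add: w_def[abs_def] W_sum[symmetric])
  qed
  have w_cont: "continuous_on {0..} w"
  proof (rule continuous_on_halfline)
    fix b :: real assume b: "0 \<le> b"
    show "continuous_on {0..b} w"
      by (rule uniform_limit_theorem[OF _ unif[OF b]])
        (auto intro!: always_eventually continuous_on_subset[OF conjunct1[OF W]])
  qed
  have lim: "(\<lambda>n. W n t) \<longlonglongrightarrow> w t" if "0 \<le> t" for t
    using tendsto_uniform_limitI[OF unif[OF that], of t] that by simp
  have w_bd: "norm (w t) \<le> C * \<psi> t" if "0 \<le> t" for t
    using Lim_bounded[OF tendsto_norm[OF lim[OF that]], of 0 "C * \<psi> t"] W that by blast
  have tail: "norm (w t - W m t) \<le> C * \<rho> ^ m * \<psi> t" if t: "0 \<le> t" for m t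
  proof (rule Lim_bounded)
    show "(\<lambda>n. norm (W (n + m) t - W m t)) \<longlonglongrightarrow> norm (w t - W m t)"
      by (intro tendsto_intros LIMSEQ_ignore_initial_segment lim[OF t])
    show "\<forall>n\<ge>0. norm (W (n + m) t - W m t) \<le> C * \<rho> ^ m * \<psi> t"
    proof (intro allI impI)
      fix n
      have "norm (W (n + m) t - W m t) \<le> K * \<rho> ^ m * (\<Sum>i<n. \<rho> ^ i) * \<psi> t"
      proof (induction n)
        case (Suc n)
        show ?case
          using Suc step[OF t, of "n + m"] norm_triangle_ineq[of "W (Suc n + m) t - W (n + m) t" "W (n + m) t - W m t"]
          by (simp add: algebra_simps power_add)
      qed simp
      also have "(\<Sum>i<n. \<rho> ^ i) \<le> 1 / (1 - \<rho>)"
        using sum_le_suminf[OF geo, of "{..<n}"] suminf_geometric[of \<rho>] \<rho> by simp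
      finally show "norm (W (n + m) t - W m t) \<le> C * \<rho> ^ m * \<psi> t"
        using K \<rho> \<psi>(2)[OF t] by (simp add: C_def field_simps mult_left_mono mult_right_mono)
    qed
  qed
  have "\<Phi> w t = w t" if t: "0 \<le> t" for t
  proof -
    have bd: "norm (\<Phi> w t - W (Suc m) t) \<le> \<rho> * (C * \<rho> ^ m) * \<psi> t" for m
      unfolding WS using w_cont W w_bd tail C \<rho> t by (intro contr[where C = C]) auto
    have "(\<lambda>m. \<rho> * (C * \<rho> ^ m) * \<psi> t) \<longlonglongrightarrow> \<rho> * (C * 0) * \<psi> t"
      using \<rho> by (intro tendsto_intros LIMSEQ_power_zero) auto
    then have "(\<lambda>m. \<Phi> w t - W (Suc m) t) \<longlonglongrightarrow> 0"
      by (intro Lim_null_comparison[OF always_eventually, of "\<lambda>m. \<Phi> w t - W (Suc m) t"]) (use bd in auto)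
    moreover have "(\<lambda>m. \<Phi> w t - W (Suc m) t) \<longlonglongrightarrow> \<Phi> w t - w t"
      by (intro tendsto_intros LIMSEQ_Suc lim[OF t])
    ultimately show ?thesis using LIMSEQ_unique by fastforce
  qed
  with w_cont w_bd show thesis by (intro that[of w]) (simp_all add: C_def)
qed

section \<open>Linear equations and their fundamental solutions\<close>

text \<open>
  Global existence in one step although the coefficient may be unbounded: for the weight
  \<open>m = exp(2 \<integral>\<beta>)\<close>, where \<open>\<beta>(t)\<close> bounds the coefficient, \<open>\<integral>\<^sub>0\<^sup>t \<beta> m = (m(t) - 1) / 2\<close>, hence the
  integral operator contracts with factor \<open>1/2\<close>. A bilinear product is allowed so that the
  coefficient can act on operators by composition from either side.
\<close>
lemma linear_ode_solution:
  fixes B :: "real \<Rightarrow> 'c::real_normed_vector" and prod :: "'c \<Rightarrow> 'b::banach \<Rightarrow> 'b"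
  assumes "bounded_bilinear prod" and B: "continuous_on {0..} B"
  obtains x where "x 0 = v"
    and "\<And>t. 0 \<le> t \<Longrightarrow> (x has_vector_derivative prod (B t) (x t)) (at t within {0..})"
proof -
  interpret bounded_bilinear prod by fact
  obtain M where M: "0 \<le> M" "\<And>a b. norm (prod a b) \<le> norm a * norm b * M"
    using nonneg_bounded by blast
  define \<beta> where "\<beta> t = M * norm (B t)" for t
  define m where "m t = exp (2 * integral {0..t} \<beta>)" for t
  have \<beta>: "continuous_on {0..} \<beta>" "0 \<le> \<beta> t" for t
    using M by (auto simp: \<beta>_def[abs_def] intro!: continuous_intros B)
  have m_deriv: "(m has_vector_derivative 2 * \<beta> t * m t) (at t within {0..})" if "0 \<le> t" for t
    using integral_has_vector_derivative_halfline[OF \<beta>(1) that]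
    unfolding m_def[abs_def] has_real_derivative_iff_has_vector_derivative[symmetric]
    by (auto intro!: derivative_eq_intros)
  have m_cont: "continuous_on {0..} m"
    using m_deriv by (rule continuous_on_halfline_of_derivative)
  have m: "0 < m t" "1 \<le> m t" if "0 \<le> t" for t
    using \<beta> that by (auto simp: m_def intro!: integral_nonneg integrable_halfline)
  have int_m: "((\<lambda>s. \<beta> s * m s) has_integral (m t - 1) / 2) {0..t}" if "0 \<le> t" for t
  proof -
    have "((\<lambda>s. 2 * \<beta> s * m s) has_integral m t - m 0) {0..t}"
      using that by (intro fundamental_theorem_of_calculus has_vector_derivative_within_subset[OF m_deriv]) auto
    from has_integral_mult_right[OF this, of "1/2"] show ?thesis
      by (simp add: m_def mult.assoc)
  qed
  have integrand: "continuous_on {0..} (\<lambda>s. prod (B s) (w s))" if "continuous_on {0..} w" for w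
    using B that by (rule continuous_on)
  define \<Phi> where "\<Phi> w t = v + integral {0..t} (\<lambda>s. prod (B s) (w s))" for w t
  have \<Phi>_deriv: "(\<Phi> w has_vector_derivative prod (B t) (w t)) (at t within {0..})"
    if "continuous_on {0..} w" "0 \<le> t" for w t
    unfolding \<Phi>_def[abs_def]
    by (auto intro!: derivative_eq_intros integral_has_vector_derivative_halfline integrand that)
  obtain w where w: "continuous_on {0..} w" "\<And>t. 0 \<le> t \<Longrightarrow> \<Phi> w t = w t"
  proof (rule weighted_contraction_fixpoint[of m "1/2" "norm v" \<Phi>])
    show "continuous_on {0..} m" by (rule m_cont)
    show "continuous_on {0..} (\<Phi> w)" if "continuous_on {0..} w" for w
      using \<Phi>_deriv[OF that] by (rule continuous_on_halfline_of_derivative)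
    show "0 \<le> m t" if "0 \<le> t" for t using m[OF that] by simp
    show "norm (\<Phi> (\<lambda>_. 0) t) \<le> norm v * m t" if "0 \<le> t" for t
      using m(2)[OF that] mult_left_mono[of 1 "m t" "norm v"] by (simp add: \<Phi>_def zero_right)
    fix x y :: "real \<Rightarrow> 'b" and d t
    assume x: "continuous_on {0..} x" and y: "continuous_on {0..} y" and "0 \<le> d" and t: "(0::real) \<le> t"
      and d: "\<And>t. 0 \<le> t \<Longrightarrow> norm (x t - y t) \<le> d * m t"
    have "norm (\<Phi> x t - \<Phi> y t) = norm (integral {0..t} (\<lambda>s. prod (B s) (x s - y s)))"
      by (simp add: \<Phi>_def diff_right integral_diff integrable_halfline integrand x y)
    also have "\<dots> \<le> integral {0..t} (\<lambda>s. d * (\<beta> s * m s))"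
    proof (rule integral_norm_bound_integral)
      show "(\<lambda>s. d * (\<beta> s * m s)) integrable_on {0..t}"
        by (intro integrable_halfline continuous_intros \<beta> m_cont) simp
      fix s assume s: "s \<in> {0..t}"
      have "norm (prod (B s) (x s - y s)) \<le> \<beta> s * norm (x s - y s)"
        using M(2)[of "B s" "x s - y s"] by (simp add: \<beta>_def mult_ac)
      also have "\<dots> \<le> \<beta> s * (d * m s)" using d[of s] s \<beta> by (intro mult_left_mono) auto
      finally show "norm (prod (B s) (x s - y s)) \<le> d * (\<beta> s * m s)" by (simp add: mult_ac)
    qed (intro integrable_halfline integrand continuous_intros x y order.refl)
    also have "\<dots> = d * ((m t - 1) / 2)" using int_m[OF t] by (simp add: integral_unique)
    also have "\<dots> \<le> 1 / 2 * d * m t" using \<open>0 \<le> d\<close> by (simp add: field_simps)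
    finally show "norm (\<Phi> x t - \<Phi> y t) \<le> 1 / 2 * d * m t" .
  qed auto
  show thesis
  proof (rule that[of w])
    show "w 0 = v" using w(2)[of 0] by (simp add: \<Phi>_def)
    show "(w has_vector_derivative prod (B t) (w t)) (at t within {0..})" if "0 \<le> t" for t
      using has_vector_derivative_transform[OF _ _ \<Phi>_deriv[OF w(1) that]] w(2) that by auto
  qed
qed

lemma id_blinfun_compose [simp]: "id_blinfun o\<^sub>L X = X"
  by (rule blinfun_eqI) simp

text \<open>
  Besides \<open>U' = A U\<close> solve \<open>V' = - V A\<close>. Then \<open>(V U)' = 0\<close>, so \<open>V\<close> is a left inverse of \<open>U\<close>. In infinite
  dimension this does not make it a right inverse, but \<open>Id - U V\<close> is then idempotent, and the norm of an
  idempotent is \<open>0\<close> or at least \<open>1\<close>. It is continuous in \<open>t\<close> and vanishes at \<open>t = 0\<close>, so it stays \<open>0\<close>.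
\<close>
lemma fundamental_solution:
  fixes A :: "real \<Rightarrow> 'a::banach \<Rightarrow>\<^sub>L 'a"
  assumes A: "continuous_on {0..} A"
  obtains U V where "\<And>t. 0 \<le> t \<Longrightarrow> (U has_vector_derivative A t o\<^sub>L U t) (at t within {0..})"
    and "continuous_on {0..} V" and "\<And>t. 0 \<le> t \<Longrightarrow> V t o\<^sub>L U t = id_blinfun"
    and "\<And>t. 0 \<le> t \<Longrightarrow> U t o\<^sub>L V t = id_blinfun" and "U 0 = id_blinfun"
proof -
  note bil = bounded_bilinear_blinfun_compose
  obtain U :: "real \<Rightarrow> 'a \<Rightarrow>\<^sub>L 'a" where U0: "U 0 = id_blinfun"
    and U: "\<And>t. 0 \<le> t \<Longrightarrow> (U has_vector_derivative A t o\<^sub>L U t) (at t within {0..})"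
    using linear_ode_solution[OF bil A, of id_blinfun] by blast
  have A': "continuous_on {0..} (\<lambda>t. - A t)" by (intro continuous_intros A)
  obtain V :: "real \<Rightarrow> 'a \<Rightarrow>\<^sub>L 'a" where V0: "V 0 = id_blinfun"
    and V: "\<And>t. 0 \<le> t \<Longrightarrow> (V has_vector_derivative V t o\<^sub>L (- A t)) (at t within {0..})"
    using linear_ode_solution[OF bounded_bilinear.flip[OF bil] A', of id_blinfun] by blast
  have cont: "continuous_on {0..} U" "continuous_on {0..} V"
    by (rule continuous_on_halfline_of_derivative, erule U) (rule continuous_on_halfline_of_derivative, erule V)
  have "((\<lambda>t. V t o\<^sub>L U t) has_vector_derivative 0) (at t within {0..})" if "0 \<le> t" for t
  proof -
    have "(V t o\<^sub>L (A t o\<^sub>L U t)) + ((V t o\<^sub>L (- A t)) o\<^sub>L U t) = 0"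
      by (rule blinfun_eqI) (simp add: blinfun.add_left blinfun.minus_left blinfun.minus_right)
    then show ?thesis
      using bounded_bilinear.has_vector_derivative[OF bil V[OF that] U[OF that]] by simp
  qed
  then obtain c where "\<And>t. t \<in> {0..} \<Longrightarrow> V t o\<^sub>L U t = c"
    using has_vector_derivative_zero_constant[of "{0..}" "\<lambda>t. V t o\<^sub>L U t"] by auto
  then have VU: "V t o\<^sub>L U t = id_blinfun" if "0 \<le> t" for t
    using that U0 V0 by (metis atLeast_iff id_blinfun_compose order.refl)
  have "U t o\<^sub>L V t = id_blinfun" if t: "0 \<le> t" for t
  proof (rule ccontr)
    define E where "E t = id_blinfun - (U t o\<^sub>L V t)" for t
    assume "\<not> ?thesis"
    then have "E t \<noteq> 0" by (simp add: E_def)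
    have idem: "E s o\<^sub>L E s = E s" if "0 \<le> s" for s
    proof (rule blinfun_eqI)
      fix x
      have "V s (U s y) = y" for y using VU[OF that] by (metis blinfun_apply_blinfun_compose blinfun_apply_id_blinfun id_apply)
      then show "(E s o\<^sub>L E s) x = E s x"
        by (simp add: E_def blinfun.diff_left blinfun.diff_right)
    qed
    have "norm (E t) \<le> norm (E t) * norm (E t)"
      using norm_blinfun_compose[of "E t" "E t"] idem[OF t] by simp
    with \<open>E t \<noteq> 0\<close> have "1 / 2 \<le> norm (E t)" by simp
    moreover have "norm (E 0) \<le> 1 / 2" by (simp add: E_def U0 V0)
    moreover have "continuous_on {0..t} (\<lambda>s. norm (E s))"
      unfolding E_def
      by (intro continuous_intros bounded_bilinear.continuous_on[OF bil] continuous_on_subset[OF cont(1)]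
          continuous_on_subset[OF cont(2)]) auto
    \<comment> \<open>The value \<open>1/2\<close> is impossible for the norm of an idempotent.\<close>
    ultimately obtain s where s: "0 \<le> s" "norm (E s) = 1 / 2"
      using IVT'[of "\<lambda>s. norm (E s)" 0 "1/2" t] t by auto
    then show False
      using norm_blinfun_compose[of "E s" "E s"] unfolding idem[OF s(1)] s(2) by simp
  qed
  then show thesis by (intro that[of U V] U cont VU U0)
qed

section \<open>The Green operator of a dichotomy\<close>

text \<open>
  An exponential dichotomy in terms of a fundamental solution \<open>U\<close> and its inverse \<open>V\<close>, with all
  projections transported back to time \<open>0\<close>, so that the Green kernel becomes a product of a function of
  \<open>t\<close> and a function of \<open>s\<close>.
\<close>
locale dichotomous_flow =
  fixes A U V :: "real \<Rightarrow> 'a::banach \<Rightarrow>\<^sub>L 'a" and P :: "'a \<Rightarrow>\<^sub>L 'a" and D l :: real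
  assumes U_deriv: "0 \<le> t \<Longrightarrow> (U has_vector_derivative A t o\<^sub>L U t) (at t within {0..})"
    and V_cont: "continuous_on {0..} V"
    and UV: "0 \<le> t \<Longrightarrow> U t o\<^sub>L V t = id_blinfun" and U_0: "U 0 = id_blinfun"
    and D: "0 < D" and l: "0 < l"
    and stable: "0 \<le> s \<Longrightarrow> s \<le> t \<Longrightarrow> norm (U t o\<^sub>L (P o\<^sub>L V s)) \<le> D * exp (- l * (t - s))"
    and unstable: "0 \<le> t \<Longrightarrow> t \<le> s \<Longrightarrow>
      norm (U t o\<^sub>L ((id_blinfun - P) o\<^sub>L V s)) \<le> D * exp (- l * (s - t))"

text \<open>
  The functions \<open>t \<mapsto> U(t) x\<close> are solutions, so \<open>T(t, s) U(s) = U(t)\<close>, and intertwining between the times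
  \<open>0\<close> and \<open>s\<close> gives \<open>P(s) = U(s) P(0) V(s)\<close>. Therefore \<open>T(t, s) P(s) = U(t) P(0) V(s)\<close>, and likewise for
  the complementary projections.
\<close>
lemma dichotomous_flow_of_exponential_dichotomy:
  assumes A: "continuous_on {0..} A" and dich: "exponential_dichotomy A D l"
  obtains U V P where "dichotomous_flow A U V P D l"
proof -
  obtain U V where U: "\<And>t. 0 \<le> t \<Longrightarrow> (U has_vector_derivative A t o\<^sub>L U t) (at t within {0..})"
    and V: "continuous_on {0..} V" and VU: "\<And>t. 0 \<le> t \<Longrightarrow> V t o\<^sub>L U t = id_blinfun"
    and UV: "\<And>t. 0 \<le> t \<Longrightarrow> U t o\<^sub>L V t = id_blinfun" and U0: "U 0 = id_blinfun"
    using fundamental_solution[OF A] by blast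
  from dich have D: "D > 0" "l > 0" unfolding exponential_dichotomy_def by blast+
  from dich obtain T P where T: "evolution_family A T"
    and "\<forall>t\<ge>0. \<forall>s\<ge>0. T t s o\<^sub>L P s = P t o\<^sub>L T t s"
    and "\<forall>s\<ge>0. \<forall>t\<ge>s. norm (T t s o\<^sub>L P s) \<le> D * exp (- l * (t - s))"
    and "\<forall>t\<ge>0. \<forall>s\<ge>t. norm (T t s o\<^sub>L (id_blinfun - P s)) \<le> D * exp (- l * (s - t))"
    unfolding exponential_dichotomy_def by (elim conjE exE)
  then have comm: "0 \<le> t \<Longrightarrow> 0 \<le> s \<Longrightarrow> T t s o\<^sub>L P s = P t o\<^sub>L T t s"
    and st: "0 \<le> s \<Longrightarrow> s \<le> t \<Longrightarrow> norm (T t s o\<^sub>L P s) \<le> D * exp (- l * (t - s))"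
    and un: "0 \<le> t \<Longrightarrow> t \<le> s \<Longrightarrow> norm (T t s o\<^sub>L (id_blinfun - P s)) \<le> D * exp (- l * (s - t))"
    for t s by blast+
  have UV': "U t (V t x) = x" if "0 \<le> t" for t x
    using UV[OF that] by (metis blinfun_apply_blinfun_compose blinfun_apply_id_blinfun id_apply)
  have TU: "T t s (U s x) = U t x" if "0 \<le> t" "0 \<le> s" for t s x
  proof -
    have "((\<lambda>t. U t x) has_vector_derivative A t (U t x)) (at t within {0..})" if "0 \<le> t" for t
      using bounded_linear.has_vector_derivative[OF blinfun.bounded_linear_left U[OF that], of x] by simp
    then have "solves (\<lambda>t v. A t v) (\<lambda>t. U t x)" by (simp add: solves_def)
    with T that show ?thesis unfolding evolution_family_def by blast
  qed
  have P: "P s x = U s (P 0 (V s x))" if "0 \<le> s" for s x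
  proof -
    have T0: "T s 0 y = U s y" for y using TU[of s 0 y] that U0 by simp
    have "P s x = (P s o\<^sub>L T s 0) (V s x)" using that by (simp add: T0 UV')
    also have "\<dots> = (T s 0 o\<^sub>L P 0) (V s x)" using comm[of s 0] that by simp
    finally show ?thesis by (simp add: T0)
  qed
  have stable_eq: "U t o\<^sub>L (P 0 o\<^sub>L V s) = T t s o\<^sub>L P s" if "0 \<le> t" "0 \<le> s" for t s
    by (rule blinfun_eqI) (simp add: P[OF that(2)] TU that)
  have unstable_eq: "U t o\<^sub>L ((id_blinfun - P 0) o\<^sub>L V s) = T t s o\<^sub>L (id_blinfun - P s)"
    if "0 \<le> t" "0 \<le> s" for t s
  proof (rule blinfun_eqI)
    fix x
    have "T t s x = U t (V s x)" using TU[of t s "V s x"] UV'[of s x] that by simp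
    then show "(U t o\<^sub>L ((id_blinfun - P 0) o\<^sub>L V s)) x = (T t s o\<^sub>L (id_blinfun - P s)) x"
      using that by (simp add: P[OF that(2)] TU blinfun.diff_left blinfun.diff_right)
  qed
  show thesis
  proof (rule that, rule dichotomous_flow.intro)
    show "norm (U t o\<^sub>L (P 0 o\<^sub>L V s)) \<le> D * exp (- l * (t - s))" if "0 \<le> s" "s \<le> t" for s t
      using st[OF that] stable_eq[of t s] that by simp
    show "norm (U t o\<^sub>L ((id_blinfun - P 0) o\<^sub>L V s)) \<le> D * exp (- l * (s - t))" if "0 \<le> t" "t \<le> s" for s t
      using un[OF that] unstable_eq[of t s] that by simp
  qed (fact U V UV U0 D)+
qed

context dichotomous_flow begin

text \<open>
  The forcing terms for which the integral over the future in the Green operator converges absolutely.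
  Taking the weight \<open>exp(-l s)\<close> at time \<open>0\<close> suffices, because applying \<open>U(t)\<close> carries the
  convergence to time \<open>t\<close>.
\<close>
definition admissible :: "(real \<Rightarrow> 'a) \<Rightarrow> bool" where
  "admissible h \<longleftrightarrow> continuous_on {0..} h \<and>
     (\<exists>C. \<forall>b\<ge>0. integral {0..b} (\<lambda>s. exp (- l * s) * norm (h s)) \<le> C)"

definition unstable_part :: "(real \<Rightarrow> 'a) \<Rightarrow> real \<Rightarrow> 'a" where
  "unstable_part h b = integral {0..b} (\<lambda>s. (id_blinfun - P) (V s (h s)))"

text \<open>
  The Green operator applied to \<open>h\<close> classically reads
  \<open>U(t) (\<integral>\<^sub>0\<^sup>t P V h - \<integral>\<^sub>t\<^sup>\<infinity> (Id - P) V h)\<close>; splitting \<open>\<integral>\<^sub>t\<^sup>\<infinity> = \<integral>\<^sub>0\<^sup>\<infinity> - \<integral>\<^sub>0\<^sup>t\<close> leaves an integral of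
  \<open>V h\<close> that can be differentiated in \<open>t\<close> and a constant vector.
\<close>
definition green :: "(real \<Rightarrow> 'a) \<Rightarrow> real \<Rightarrow> 'a" where
  "green h t = U t (integral {0..t} (\<lambda>s. V s (h s)) - lim (\<lambda>n. unstable_part h (real n)))"

lemma V_apply_cont: "continuous_on {0..} h \<Longrightarrow> continuous_on {0..} (\<lambda>s. V s (h s))"
  by (intro continuous_intros V_cont)

text \<open>
  At \<open>t = 0\<close> the bound on the unstable kernel reads \<open>|(Id - P) V(s)| \<le> D exp(-l s)\<close>, so the increments
  of the vector integrals are dominated by those of a bounded increasing sequence of real integrals.
\<close>
lemma unstable_part_convergent:
  assumes "admissible h"
  shows "(\<lambda>n. unstable_part h (real n)) \<longlonglongrightarrow> lim (\<lambda>n. unstable_part h (real n))"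
proof -
  from assms obtain C where h: "continuous_on {0..} h"
    and C: "\<And>b. 0 \<le> b \<Longrightarrow> integral {0..b} (\<lambda>s. exp (- l * s) * norm (h s)) \<le> C"
    unfolding admissible_def by blast
  define u where "u s = (id_blinfun - P) (V s (h s))" for s
  define g where "g s = exp (- l * s) * norm (h s)" for s
  have u: "continuous_on {0..} u" and g: "continuous_on {0..} g"
    unfolding u_def[abs_def] g_def[abs_def] by (intro continuous_intros V_cont h)+
  have ug: "norm (u s) \<le> D * g s" if "0 \<le> s" for s
  proof -
    have "norm (u s) \<le> norm ((id_blinfun - P) o\<^sub>L V s) * norm (h s)"
      using norm_blinfun[of "(id_blinfun - P) o\<^sub>L V s" "h s"] by (simp add: u_def)
    also have "\<dots> \<le> D * exp (- l * s) * norm (h s)"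
      using unstable[of 0 s] that by (intro mult_right_mono) (auto simp: U_0)
    finally show ?thesis by (simp add: g_def)
  qed
  have split: "integral {0..b} k - integral {0..a} k = integral {a..b} k"
    if "0 \<le> a" "a \<le> b" "continuous_on {0..} k" for a b and k :: "real \<Rightarrow> 'c::banach"
    using Henstock_Kurzweil_Integration.integral_combine[of 0 a b k] that integrable_halfline[of k 0 b]
    by (simp add: algebra_simps)
  have le: "norm (unstable_part h b - unstable_part h a) \<le> D * (integral {0..b} g - integral {0..a} g)"
    if "0 \<le> a" "a \<le> b" for a b
  proof -
    have "norm (integral {a..b} u) \<le> integral {a..b} (\<lambda>s. D * g s)"
      using that by (intro integral_norm_bound_integral integrable_halfline continuous_intros u g ug) auto
    then show ?thesis using that by (simp add: unstable_part_def u_def[symmetric] split u g)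
  qed
  have "incseq (\<lambda>n. integral {0..real n} g)"
  proof (rule incseq_SucI)
    fix n
    have "0 \<le> integral {real n..real (Suc n)} g"
      by (intro integral_nonneg integrable_halfline g) (auto simp: g_def)
    then show "integral {0..real n} g \<le> integral {0..real (Suc n)} g"
      using split[OF _ _ g, of "real n" "real (Suc n)"] by simp
  qed
  moreover have "\<And>n. integral {0..real n} g \<le> C" using C by (simp add: g_def[abs_def])
  ultimately have "Cauchy (\<lambda>n. integral {0..real n} g)"
    by (metis LIMSEQ_imp_Cauchy incseq_convergent)
  have "Cauchy (\<lambda>n. unstable_part h (real n))"
  proof (rule CauchyI')
    fix e :: real assume "0 < e"
    then obtain N where N: "\<And>m n. N \<le> m \<Longrightarrow> N \<le> n
        \<Longrightarrow> norm (integral {0..real m} g - integral {0..real n} g) < e / D"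
      using CauchyD[OF \<open>Cauchy (\<lambda>n. integral {0..real n} g)\<close>, of "e / D"] D by auto
    have "norm (unstable_part h (real m) - unstable_part h (real n)) < e" if "N \<le> m" "m < n" for m n
    proof -
      have "norm (unstable_part h (real n) - unstable_part h (real m))
          \<le> D * (integral {0..real n} g - integral {0..real m} g)" using that by (intro le) auto
      also have "\<dots> < e" using N[of n m] that D by (simp add: field_simps abs_less_iff)
      finally show ?thesis by (simp add: norm_minus_commute)
    qed
    then show "\<exists>N. \<forall>m\<ge>N. \<forall>n>m. dist (unstable_part h (real m)) (unstable_part h (real n)) < e"
      unfolding dist_norm by blast
  qed
  then show ?thesis by (simp add: Cauchy_convergent_iff convergent_LIMSEQ_iff)
qed

lemma green_has_vector_derivative:
  assumes h: "continuous_on {0..} h" and t: "0 \<le> t"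
  shows "(green h has_vector_derivative A t (green h t) + h t) (at t within {0..})"
proof -
  define L where "L = lim (\<lambda>n. unstable_part h (real n))"
  have "((\<lambda>t. integral {0..t} (\<lambda>s. V s (h s)) - L) has_vector_derivative V t (h t)) (at t within {0..})"
    by (auto intro!: derivative_eq_intros integral_has_vector_derivative_halfline V_apply_cont h t)
  from bounded_bilinear.has_vector_derivative[OF bounded_bilinear_blinfun_apply U_deriv[OF t] this]
  have "(green h has_vector_derivative U t (V t (h t)) + A t (green h t)) (at t within {0..})"
    by (simp add: green_def[abs_def] L_def)
  moreover have "U t (V t (h t)) = h t"
    using UV[OF t] by (metis blinfun_apply_blinfun_compose blinfun_apply_id_blinfun id_apply)
  ultimately show ?thesis by (simp add: add.commute)
qed

text \<open>
  For \<open>n \<ge> t\<close> the approximants are \<open>\<integral>\<^sub>0\<^sup>t U(t) P V h - \<integral>\<^sub>t\<^sup>n U(t) (Id - P) V h\<close>, and the two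
  dichotomy estimates bound them by one integral against the kernel \<open>D exp(-l|t - s|)\<close>.
\<close>
lemma norm_green_le:
  assumes adm: "admissible h" and t: "0 \<le> t"
    and C: "\<And>b. t \<le> b \<Longrightarrow> integral {0..b} (\<lambda>s. exp (- l * \<bar>t - s\<bar>) * norm (h s)) \<le> C"
  shows "norm (green h t) \<le> D * C"
proof (rule Lim_bounded)
  have h: "continuous_on {0..} h" using adm by (simp add: admissible_def)
  show "(\<lambda>n. norm (U t (integral {0..t} (\<lambda>s. V s (h s)) - unstable_part h (real n)))) \<longlonglongrightarrow> norm (green h t)"
    unfolding green_def by (intro tendsto_intros unstable_part_convergent adm)
  show "\<forall>n\<ge>nat \<lceil>t\<rceil>. norm (U t (integral {0..t} (\<lambda>s. V s (h s)) - unstable_part h (real n))) \<le> D * C"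
  proof (intro allI impI)
    fix n assume "nat \<lceil>t\<rceil> \<le> n"
    then have n: "t \<le> real n" by linarith
    define k where "k s = D * (exp (- l * \<bar>t - s\<bar>) * norm (h s))" for s
    have k: "continuous_on {0..} k" unfolding k_def by (intro continuous_intros h)
    define p where "p s = P (V s (h s))" for s
    define q where "q s = (id_blinfun - P) (V s (h s))" for s
    have p: "continuous_on {0..} p" and q: "continuous_on {0..} q"
      unfolding p_def[abs_def] q_def[abs_def] by (intro continuous_intros V_cont h)+
    have pq: "(\<lambda>s. V s (h s)) = (\<lambda>s. p s + q s)" by (simp add: p_def q_def blinfun.diff_left)
    have split: "unstable_part h (real n) = integral {0..t} q + integral {t..real n} q"
      unfolding unstable_part_def q_def[symmetric]
      using Henstock_Kurzweil_Integration.integral_combine[OF t n integrable_halfline[OF q, of 0]] by simp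
    have eq: "U t (integral {0..t} (\<lambda>s. V s (h s)) - unstable_part h (real n))
        = integral {0..t} (\<lambda>s. U t (p s)) - integral {t..real n} (\<lambda>s. U t (q s))"
      using t unfolding split pq
      by (simp add: integral_add integrable_halfline p q blinfun.diff_right
          integral_linear[OF _ blinfun.bounded_linear_right, unfolded o_def])
    have "norm (integral {0..t} (\<lambda>s. U t (p s))) \<le> integral {0..t} k"
    proof (rule integral_norm_bound_integral)
      fix s assume s: "s \<in> {0..t}"
      have "norm (U t (p s)) \<le> norm (U t o\<^sub>L (P o\<^sub>L V s)) * norm (h s)"
        using norm_blinfun[of "U t o\<^sub>L (P o\<^sub>L V s)" "h s"] by (simp add: p_def)
      also have "\<dots> \<le> D * exp (- l * (t - s)) * norm (h s)"
        using s by (intro mult_right_mono stable) auto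
      finally show "norm (U t (p s)) \<le> k s" using s by (simp add: k_def)
    qed (intro integrable_halfline continuous_intros p k order.refl)+
    moreover have "norm (integral {t..real n} (\<lambda>s. U t (q s))) \<le> integral {t..real n} k"
    proof (rule integral_norm_bound_integral)
      fix s assume s: "s \<in> {t..real n}"
      have "norm (U t (q s)) \<le> norm (U t o\<^sub>L ((id_blinfun - P) o\<^sub>L V s)) * norm (h s)"
        using norm_blinfun[of "U t o\<^sub>L ((id_blinfun - P) o\<^sub>L V s)" "h s"] by (simp add: q_def)
      also have "\<dots> \<le> D * exp (- l * (s - t)) * norm (h s)"
        using s t by (intro mult_right_mono unstable) auto
      finally show "norm (U t (q s)) \<le> k s" using s by (simp add: k_def)
    qed (intro integrable_halfline continuous_intros q k t)+
    moreover have "integral {0..t} k + integral {t..real n} k = integral {0..real n} k"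
      using Henstock_Kurzweil_Integration.integral_combine[OF t n integrable_halfline[OF k, of 0]] by simp
    moreover have "integral {0..real n} k \<le> D * C"
      using C[OF n] D by (simp add: k_def[abs_def])
    ultimately show "norm (U t (integral {0..t} (\<lambda>s. V s (h s)) - unstable_part h (real n))) \<le> D * C"
      unfolding eq using norm_triangle_ineq4[of "integral {0..t} (\<lambda>s. U t (p s))" "integral {t..real n} (\<lambda>s. U t (q s))"]
      by linarith
  qed
qed

lemma green_diff:
  assumes "admissible h" and "admissible k" and t: "0 \<le> t"
  shows "green h t - green k t = green (\<lambda>s. h s - k s) t"
proof -
  have cont: "continuous_on {0..} h" "continuous_on {0..} k" using assms by (auto simp: admissible_def)
  have int: "(\<lambda>s. B (V s (w s))) integrable_on {0..b}" if "continuous_on {0..} w" for w b and B :: "'a \<Rightarrow>\<^sub>L 'a"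
    by (intro integrable_halfline continuous_intros V_cont that order.refl)
  have "unstable_part (\<lambda>s. h s - k s) b = unstable_part h b - unstable_part k b" for b
    by (simp add: unstable_part_def blinfun.diff_right integral_diff int cont)
  then have 1: "lim (\<lambda>n. unstable_part (\<lambda>s. h s - k s) (real n))
      = lim (\<lambda>n. unstable_part h (real n)) - lim (\<lambda>n. unstable_part k (real n))"
    by (auto intro!: limI tendsto_diff unstable_part_convergent assms)
  have 2: "integral {0..t} (\<lambda>s. V s (h s - k s))
      = integral {0..t} (\<lambda>s. V s (h s)) - integral {0..t} (\<lambda>s. V s (k s))"
    using int[of _ id_blinfun] cont by (simp add: blinfun.diff_right integral_diff)
  show ?thesis unfolding green_def 1 2 by (simp only: blinfun.diff_right) simp
qed

end

section \<open>Convolution with a two-sided exponential\<close>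

text \<open>
  Convolution on the whole line with \<open>exp(-\<mu>|t|)\<close>; functions on the half-line enter extended by \<open>0\<close>.
\<close>
definition exp_potential :: "real \<Rightarrow> (real \<Rightarrow> real) \<Rightarrow> real \<Rightarrow> ennreal" where
  "exp_potential \<mu> g t = (\<integral>\<^sup>+s. ennreal (exp (- \<mu> * \<bar>t - s\<bar>) * g s) \<partial>lborel)"

lemma nn_integral_exp_kernel_le:
  assumes \<mu>: "0 < \<mu>"
  shows "(\<integral>\<^sup>+s. ennreal (exp (- \<mu> * \<bar>t - s\<bar>)) \<partial>lborel) \<le> ennreal (2 / \<mu>)"
proof -
  define e where "e x = ennreal (exp (- \<mu> * x)) * indicator {0..} x" for x :: real
  have [measurable]: "e \<in> borel_measurable borel" unfolding e_def[abs_def] by measurable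
  have "((\<lambda>x. - exp (- \<mu> * x) / \<mu>) \<longlongrightarrow> - 0 / \<mu>) at_top"
    using \<mu> by (intro tendsto_intros filterlim_compose[OF exp_at_bot]
        filterlim_tendsto_neg_mult_at_bot[OF tendsto_const]) (auto simp: filterlim_ident)
  then have e: "(\<integral>\<^sup>+x. e x \<partial>lborel) = ennreal (1 / \<mu>)"
    unfolding e_def using \<mu>
    by (subst nn_integral_FTC_atLeast[where F = "\<lambda>x. - exp (- \<mu> * x) / \<mu>" and T = 0])
      (auto intro!: derivative_eq_intros)
  have "(\<integral>\<^sup>+s. ennreal (exp (- \<mu> * \<bar>t - s\<bar>)) \<partial>lborel) = (\<integral>\<^sup>+x. ennreal (exp (- \<mu> * \<bar>x\<bar>)) \<partial>lborel)"
    by (subst nn_integral_real_affine[where c = 1 and t = t]) (auto simp: abs_minus_commute)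
  also have "\<dots> \<le> (\<integral>\<^sup>+x. e x + e (- x) \<partial>lborel)"
    by (intro nn_integral_mono) (auto simp: e_def indicator_def abs_if)
  also have "\<dots> = (\<integral>\<^sup>+x. e x \<partial>lborel) + (\<integral>\<^sup>+x. e (- x) \<partial>lborel)"
    by (intro nn_integral_add) measurable
  also have "(\<integral>\<^sup>+x. e (- x) \<partial>lborel) = (\<integral>\<^sup>+x. e x \<partial>lborel)"
    using nn_integral_real_affine[of e "-1" 0] by simp
  also have "(\<integral>\<^sup>+x. e x \<partial>lborel) + (\<integral>\<^sup>+x. e x \<partial>lborel) = ennreal (2 / \<mu>)"
    using \<mu> by (simp add: e flip: ennreal_plus)
  finally show ?thesis .
qed

text \<open>
  By the triangle inequality, moving the centre of the kernel from \<open>t\<close> to \<open>u\<close> costs at most the factor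
  \<open>exp(\<mu>|t - u|)\<close>.
\<close>
lemma exp_potential_slow_variation:
  assumes [measurable]: "g \<in> borel_measurable borel" and \<mu>: "0 \<le> \<mu>" and g: "\<And>s. 0 \<le> g s"
  shows "exp_potential \<mu> g u \<le> ennreal (exp (\<mu> * \<bar>t - u\<bar>)) * exp_potential \<mu> g t"
proof -
  have "exp (- \<mu> * \<bar>u - s\<bar>) * g s \<le> exp (\<mu> * \<bar>t - u\<bar>) * (exp (- \<mu> * \<bar>t - s\<bar>) * g s)" for s
  proof -
    have "\<mu> * \<bar>t - s\<bar> \<le> \<mu> * \<bar>t - u\<bar> + \<mu> * \<bar>u - s\<bar>"
      using \<mu> by (simp flip: distrib_left) (intro mult_left_mono; linarith)
    then have "exp (- \<mu> * \<bar>u - s\<bar>) \<le> exp (\<mu> * \<bar>t - u\<bar>) * exp (- \<mu> * \<bar>t - s\<bar>)"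
      by (simp flip: exp_add)
    from mult_right_mono[OF this g[of s]] show ?thesis by (simp add: mult.assoc)
  qed
  then have "exp_potential \<mu> g u \<le> (\<integral>\<^sup>+s. ennreal (exp (\<mu> * \<bar>t - u\<bar>)) * ennreal (exp (- \<mu> * \<bar>t - s\<bar>) * g s) \<partial>lborel)"
    unfolding exp_potential_def by (intro nn_integral_mono) (simp add: g flip: ennreal_mult)
  also have "\<dots> = ennreal (exp (\<mu> * \<bar>t - u\<bar>)) * exp_potential \<mu> g t"
    unfolding exp_potential_def by (intro nn_integral_cmult) measurable
  finally show ?thesis .
qed

text \<open>
  The tangent line of \<open>x \<mapsto> x\<^sup>q\<close> at \<open>x = a\<close>, solved for \<open>x\<close>.
\<close>
lemma Young_scaled:
  fixes a x q :: real
  assumes "0 < a" "0 \<le> x" "1 \<le> q"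
  shows "x \<le> a * (1 - 1 / q) + a powr (1 - q) / q * x powr q"
proof (cases "x = 0")
  case True
  then show ?thesis using assms by simp
next
  case False
  then have x: "0 < x" using assms by simp
  have "(x powr q * a powr (1 - q)) powr (1 / q) * a powr (1 - 1 / q)
      = x powr (q * (1 / q)) * a powr ((1 - q) * (1 / q) + (1 - 1 / q))"
    using x assms by (simp add: powr_mult powr_powr powr_add)
  also have "\<dots> = x" using x assms by (simp add: field_simps)
  finally show ?thesis
    using Youngs_inequality_0[of "1 / q" "1 - 1 / q" "x powr q * a powr (1 - q)" a] assms x
    by (simp add: algebra_simps)
qed

text \<open>
  Jensen's inequality for the convex function \<open>x \<mapsto> x\<^sup>q\<close> and the kernel, whose mass is at most
  \<open>\<kappa> = 2 / \<mu>\<close>. Integrating the tangent inequality at \<open>a\<close> against the kernel gives a family of bounds,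
  and \<open>a = (j / \<kappa>)\<^bsup>1/q\<^esup>\<close> is the best one. If \<open>j = 0\<close> this \<open>a\<close> is not allowed and
  the bound follows by letting \<open>j\<close> decrease to \<open>0\<close>.
\<close>
lemma exp_potential_Jensen:
  assumes [measurable]: "g \<in> borel_measurable borel" and \<mu>: "0 < \<mu>" and g: "\<And>s. 0 \<le> g s"
    and q: "1 \<le> q" and j: "exp_potential \<mu> (\<lambda>s. g s powr q) t \<le> ennreal j" "0 \<le> j"
  shows "exp_potential \<mu> g t \<le> ennreal (((2 / \<mu>) powr (q - 1) * j) powr (1 / q))"
proof -
  define \<kappa> where "\<kappa> = 2 / \<mu>"
  have \<kappa>: "0 < \<kappa>" using \<mu> by (simp add: \<kappa>_def)
  have Young: "exp_potential \<mu> g t \<le> ennreal (a * (1 - 1 / q) * \<kappa> + a powr (1 - q) / q * j)" if a: "0 < a" for a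
  proof -
    have c: "0 \<le> a * (1 - 1 / q)" "0 \<le> a powr (1 - q) / q" using a q by simp_all
    have "exp (- \<mu> * \<bar>t - s\<bar>) * g s \<le> a * (1 - 1 / q) * exp (- \<mu> * \<bar>t - s\<bar>)
        + a powr (1 - q) / q * (exp (- \<mu> * \<bar>t - s\<bar>) * g s powr q)" for s
      using mult_left_mono[OF Young_scaled[OF a g[of s] q], of "exp (- \<mu> * \<bar>t - s\<bar>)"]
      by (simp add: algebra_simps)
    then have "exp_potential \<mu> g t \<le> (\<integral>\<^sup>+s. ennreal (a * (1 - 1 / q)) * ennreal (exp (- \<mu> * \<bar>t - s\<bar>))
        + ennreal (a powr (1 - q) / q) * ennreal (exp (- \<mu> * \<bar>t - s\<bar>) * g s powr q) \<partial>lborel)"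
      unfolding exp_potential_def using c
      by (intro nn_integral_mono) (simp del: times_divide_eq_left flip: ennreal_mult ennreal_plus)
    also have "\<dots> = ennreal (a * (1 - 1 / q)) * (\<integral>\<^sup>+s. ennreal (exp (- \<mu> * \<bar>t - s\<bar>)) \<partial>lborel)
        + ennreal (a powr (1 - q) / q) * exp_potential \<mu> (\<lambda>s. g s powr q) t"
      unfolding exp_potential_def by (subst nn_integral_add) (auto simp: nn_integral_cmult)
    also have "\<dots> \<le> ennreal (a * (1 - 1 / q)) * ennreal \<kappa> + ennreal (a powr (1 - q) / q) * ennreal j"
      unfolding \<kappa>_def by (intro add_mono mult_left_mono nn_integral_exp_kernel_le \<mu> j) auto
    also have "\<dots> = ennreal (a * (1 - 1 / q) * \<kappa> + a powr (1 - q) / q * j)"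
      using c \<kappa> j(2) by (subst ennreal_plus) (auto simp: ennreal_mult simp del: times_divide_eq_left)
    finally show ?thesis .
  qed
  have opt: "exp_potential \<mu> g t \<le> ennreal ((\<kappa> powr (q - 1) * i) powr (1 / q))"
    if i: "0 < i" "j \<le> i" for i
  proof -
    have qq: "q * (1 / q) = 1" using q by simp
    define a where "a = (i / \<kappa>) powr (1 / q)"
    have a: "0 < a" and aq: "a powr q = i / \<kappa>" using i \<kappa> q by (auto simp: a_def powr_powr)
    have "a powr (1 - q) * i = a * \<kappa>"
      using a aq \<kappa> i(1) by (simp add: powr_diff)
    then have "a * (1 - 1 / q) * \<kappa> + a powr (1 - q) / q * i = \<kappa> * a"
      by (simp add: field_simps)
    moreover have "a powr (1 - q) / q * j \<le> a powr (1 - q) / q * i" using i q by (intro mult_left_mono) auto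
    ultimately have "exp_potential \<mu> g t \<le> ennreal (\<kappa> * a)"
      by (intro order_trans[OF Young[OF a]] ennreal_leI) linarith
    also have "\<kappa> * a = (\<kappa> powr q * (i / \<kappa>)) powr (1 / q)"
      using \<kappa> i qq by (simp add: a_def powr_mult powr_powr del: times_divide_eq_right)
    also have "\<kappa> powr q * (i / \<kappa>) = \<kappa> powr (q - 1) * i" using \<kappa> by (simp add: powr_diff)
    finally show ?thesis .
  qed
  show ?thesis
  proof (cases "j = 0")
    case False
    then show ?thesis using opt[of j] j by (simp add: \<kappa>_def)
  next
    case True
    have "((\<lambda>i. ennreal ((\<kappa> powr (q - 1) * i) powr (1 / q))) \<longlongrightarrow> ennreal ((\<kappa> powr (q - 1) * 0) powr (1 / q))) (at_right 0)"
      by (intro tendsto_ennrealI tendsto_powr' tendsto_intros)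
        (use q \<kappa> in \<open>auto intro!: eventually_at_rightI[of 0 1]\<close>)
    then have "exp_potential \<mu> g t \<le> ennreal ((\<kappa> powr (q - 1) * 0) powr (1 / q))"
      by (rule tendsto_lowerbound) (use opt True in \<open>auto intro!: eventually_at_rightI[of 0 1]\<close>)
    then show ?thesis by (simp add: True \<kappa>_def)
  qed
qed

lemma nn_integral_exp_potential_le:
  assumes [measurable]: "g \<in> borel_measurable borel" and \<mu>: "0 < \<mu>" and g: "\<And>s. 0 \<le> g s"
  shows "(\<integral>\<^sup>+t. exp_potential \<mu> g t \<partial>lborel) \<le> ennreal (2 / \<mu>) * (\<integral>\<^sup>+s. ennreal (g s) \<partial>lborel)"
proof -
  have "(\<integral>\<^sup>+t. exp_potential \<mu> g t \<partial>lborel)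
      = (\<integral>\<^sup>+s. (\<integral>\<^sup>+t. ennreal (g s) * ennreal (exp (- \<mu> * \<bar>s - t\<bar>)) \<partial>lborel) \<partial>lborel)"
    unfolding exp_potential_def
    by (subst lborel_pair.Fubini') (auto simp: g ennreal_mult mult.commute abs_minus_commute)
  also have "\<dots> \<le> (\<integral>\<^sup>+s. ennreal (g s) * ennreal (2 / \<mu>) \<partial>lborel)"
    using nn_integral_exp_kernel_le[OF \<mu>] by (intro nn_integral_mono) (simp add: nn_integral_cmult mult_left_mono)
  also have "\<dots> = ennreal (2 / \<mu>) * (\<integral>\<^sup>+s. ennreal (g s) \<partial>lborel)"
    by (simp add: nn_integral_multc mult.commute)
  finally show ?thesis .
qed

text \<open>
  The case \<open>p = \<infinity>\<close> of Young's inequality: the kernel is at most \<open>1\<close>, so the potential of \<open>g\<^sup>q\<close> is at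
  most the integral of \<open>g\<^sup>q\<close>, and Jensen's inequality applies.
\<close>
lemma exp_potential_le_of_powr_integral:
  assumes [measurable]: "g \<in> borel_measurable borel" and \<mu>: "0 < \<mu>" and g: "\<And>s. 0 \<le> g s"
    and q: "1 \<le> q" and \<epsilon>: "0 < \<epsilon>" "(\<integral>\<^sup>+s. ennreal (g s powr q) \<partial>lborel) \<le> ennreal (\<epsilon> powr q)"
  shows "exp_potential \<mu> g t \<le> ennreal (max 1 (2 / \<mu>) * \<epsilon>)"
proof -
  define M where "M = max 1 (2 / \<mu>)"
  have "exp_potential \<mu> (\<lambda>s. g s powr q) t \<le> (\<integral>\<^sup>+s. ennreal (g s powr q) \<partial>lborel)"
    unfolding exp_potential_def
    by (intro nn_integral_mono ennreal_leI mult_left_le_one_le) (use \<mu> in auto)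
  also note \<epsilon>(2)
  finally have "exp_potential \<mu> g t \<le> ennreal (((2 / \<mu>) powr (q - 1) * \<epsilon> powr q) powr (1 / q))"
    by (intro exp_potential_Jensen \<mu> g q) auto
  also have "((2 / \<mu>) powr (q - 1) * \<epsilon> powr q) powr (1 / q) \<le> (M powr q * \<epsilon> powr q) powr (1 / q)"
  proof -
    have "(2 / \<mu>) powr (q - 1) \<le> M powr (q - 1)"
      using \<mu> q by (intro powr_mono2) (auto simp: M_def)
    also have "\<dots> \<le> M powr q" by (intro powr_mono) (auto simp: M_def)
    finally show ?thesis using q by (intro powr_mono2 mult_right_mono) auto
  qed
  also have "(M powr q * \<epsilon> powr q) powr (1 / q) = M * \<epsilon>"
    using \<epsilon> q by (simp add: M_def powr_mult powr_powr)
  finally show ?thesis by (simp add: M_def ennreal_leI)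
qed

text \<open>
  Interpolation between \<open>L\<^sup>q\<close> and \<open>L\<^sup>\<infinity>\<close>: split \<open>\<psi>\<^sup>p = \<psi>\<^bsup>p-q\<^esup> \<psi>\<^sup>q\<close>, bound the first factor by the
  supremum and the second by Jensen's inequality, whose right-hand side is integrated by Tonelli's theorem.
\<close>
lemma nn_integral_exp_potential_powr_le:
  assumes [measurable]: "g \<in> borel_measurable borel" and \<mu>: "0 < \<mu>" and g: "\<And>s. 0 \<le> g s"
    and q: "1 \<le> q" "q \<le> p" and \<epsilon>: "0 < \<epsilon>" "(\<integral>\<^sup>+s. ennreal (g s powr q) \<partial>lborel) \<le> ennreal (\<epsilon> powr q)"
  shows "(\<integral>\<^sup>+t. ennreal (enn2real (exp_potential \<mu> g t) powr p) \<partial>lborel)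
    \<le> ennreal ((max 1 (2 / \<mu>) * \<epsilon>) powr p)"
proof -
  define M where "M = max 1 (2 / \<mu>)"
  define \<kappa> where "\<kappa> = 2 / \<mu>"
  define J where "J = exp_potential \<mu> (\<lambda>s. g s powr q)"
  have M: "1 \<le> M" "\<kappa> \<le> M" and \<kappa>: "0 < \<kappa>" using \<mu> by (auto simp: M_def \<kappa>_def)
  have [measurable]: "J \<in> borel_measurable borel"
    unfolding J_def exp_potential_def[abs_def] by measurable
  have "J t \<le> (\<integral>\<^sup>+s. ennreal (g s powr q) \<partial>lborel)" for t
    unfolding J_def exp_potential_def
    by (intro nn_integral_mono ennreal_leI mult_left_le_one_le) (use \<mu> in auto)
  then have J_fin: "J t < \<infinity>" for t using \<epsilon>(2) by (metis ennreal_less_top infinity_ennreal_def order.strict_trans1)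
  have pt: "ennreal (enn2real (exp_potential \<mu> g t) powr p)
      \<le> ennreal ((M * \<epsilon>) powr (p - q) * \<kappa> powr (q - 1)) * J t" for t
  proof -
    define x where "x = enn2real (exp_potential \<mu> g t)"
    have x: "0 \<le> x" "x \<le> M * \<epsilon>"
      using exp_potential_le_of_powr_integral[where g = g and t = t, OF _ \<mu> g q(1) \<epsilon>] \<epsilon> M
      by (auto simp: x_def M_def intro!: enn2real_leI)
    obtain j where j: "J t = ennreal j" "0 \<le> j" using J_fin[of t] by (cases "J t") auto
    have "x \<le> (\<kappa> powr (q - 1) * j) powr (1 / q)"
      using exp_potential_Jensen[where g = g and t = t and j = j, OF _ \<mu> g q(1)] j unfolding J_def x_def \<kappa>_def
      by (intro enn2real_leI) auto
    then have "x powr q \<le> ((\<kappa> powr (q - 1) * j) powr (1 / q)) powr q"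
      using x q by (intro powr_mono2) auto
    also have "\<dots> = \<kappa> powr (q - 1) * j" using q j \<kappa> by (simp add: powr_powr)
    finally have *: "x powr q \<le> \<kappa> powr (q - 1) * j" .
    have "x powr p = x powr (p - q) * x powr q" by (simp flip: powr_add)
    also have "\<dots> \<le> (M * \<epsilon>) powr (p - q) * (\<kappa> powr (q - 1) * j)"
      using * x q by (intro mult_mono powr_mono2) auto
    finally show ?thesis unfolding x_def j by (simp add: j ennreal_mult mult.assoc flip: ennreal_mult ennreal_mult'')
  qed
  have "(\<integral>\<^sup>+t. ennreal (enn2real (exp_potential \<mu> g t) powr p) \<partial>lborel)
      \<le> ennreal ((M * \<epsilon>) powr (p - q) * \<kappa> powr (q - 1)) * (\<integral>\<^sup>+t. J t \<partial>lborel)"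
    by (subst nn_integral_cmult[symmetric]) (auto intro!: nn_integral_mono pt)
  also have "\<dots> \<le> ennreal ((M * \<epsilon>) powr (p - q) * \<kappa> powr (q - 1)) * (ennreal \<kappa> * ennreal (\<epsilon> powr q))"
    unfolding J_def \<kappa>_def
    by (intro mult_left_mono order_trans[OF nn_integral_exp_potential_le[OF _ \<mu>]] \<epsilon>(2)) auto
  also have "\<dots> = ennreal ((M * \<epsilon>) powr (p - q) * (\<kappa> powr q * \<epsilon> powr q))"
    using \<kappa> by (simp add: powr_diff flip: ennreal_mult)
  also have "\<dots> \<le> ennreal ((M * \<epsilon>) powr (p - q) * (M * \<epsilon>) powr q)"
    using M \<kappa> \<epsilon> q by (intro ennreal_leI mult_left_mono) (auto simp: powr_mult intro!: mult_right_mono powr_mono2)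
  also have "\<dots> = ennreal ((M * \<epsilon>) powr p)" by (simp flip: powr_add)
  finally show ?thesis by (simp add: M_def)
qed

section \<open>Lebesgue spaces on the half-line\<close>

lemma nn_integral_lebesgue_on_halfline:
  "(\<integral>\<^sup>+t. f t \<partial>lebesgue_on {0..}) = (\<integral>\<^sup>+t. f t * indicator {0..} t \<partial>lborel)" for f :: "real \<Rightarrow> ennreal"
  by (simp add: nn_integral_restrict_space nn_integral_completion)

lemma borel_measurable_halfline_extension:
  fixes r :: "real \<Rightarrow> 'b::real_normed_vector"
  assumes "continuous_on {0..} r"
  shows "(\<lambda>t. indicator {0..} t * norm (r t)) \<in> borel_measurable borel"
proof -
  have "continuous_on {0..} (\<lambda>t. norm (r t))" by (intro continuous_intros assms)
  from borel_measurable_continuous_on_indicator[OF _ this] show ?thesis by simp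
qed

text \<open>
  Approximating the identity of the half-line by simple real functions and composing with \<open>x\<close> gives
  simple functions with values in the range of \<open>x\<close>, so the target space may be non-separable.
\<close>
lemma bochner_measurable_continuous:
  fixes x :: "real \<Rightarrow> 'b::real_normed_vector"
  assumes x: "continuous_on {0..} x"
  shows "bochner_measurable (lebesgue_on {0..}) x"
proof -
  have "(\<lambda>t. t) \<in> borel_measurable (lebesgue_on {0::real..})"
    by (intro continuous_imp_measurable_on_sets_lebesgue continuous_intros) auto
  from borel_measurable_implies_sequence_metric[OF this, of 0]
  obtain F :: "nat \<Rightarrow> real \<Rightarrow> real" where F: "\<And>i. simple_function (lebesgue_on {0..}) (F i)"
    and lim: "\<And>t. 0 \<le> t \<Longrightarrow> (\<lambda>i. F i t) \<longlonglongrightarrow> t"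
    by (auto simp: space_restrict_space)
  define s where "s i t = x (max 0 (F i t))" for i t
  have "simple_function (lebesgue_on {0..}) (s i)" for i
    unfolding s_def using simple_function_compose1[OF F[of i], of "\<lambda>u. x (max 0 u)"] by simp
  moreover have "(\<lambda>i. s i t) \<longlonglongrightarrow> x t" if t: "0 \<le> t" for t
  proof -
    have "(\<lambda>i. max 0 (F i t)) \<longlonglongrightarrow> max 0 t" by (intro tendsto_intros lim t)
    then show ?thesis
      unfolding s_def using continuous_on_tendsto_compose[OF x, of "\<lambda>i. max 0 (F i t)" t sequentially] t by simp
  qed
  ultimately show ?thesis
    unfolding bochner_measurable_def by (intro exI[of _ s]) (auto simp: space_restrict_space intro!: AE_I2)
qed

lemma Lp_finite_intro:
  fixes z :: "real \<Rightarrow> 'a::banach"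
  assumes z: "continuous_on {0..} z" and p: "1 \<le> p" and B: "0 \<le> B"
    and le: "(\<integral>\<^sup>+t. ennreal (indicator {0..} t * norm (z t) powr p) \<partial>lborel) \<le> ennreal (B powr p)"
  shows "z \<in> Lp_space (ennreal p)" and "Lp_norm (ennreal p) z \<le> B"
proof -
  define N where "N = (\<integral>\<^sup>+t. ennreal (norm (z t) powr p) \<partial>lebesgue_on {0..})"
  have "N = (\<integral>\<^sup>+t. ennreal (indicator {0..} t * norm (z t) powr p) \<partial>lborel)"
    unfolding N_def nn_integral_lebesgue_on_halfline
    by (intro nn_integral_cong) (simp split: split_indicator)
  with le have N: "N \<le> ennreal (B powr p)" by simp
  then have "N < \<infinity>" by (metis ennreal_less_top infinity_ennreal_def order.strict_trans1)
  then show "z \<in> Lp_space (ennreal p)"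
    using bochner_measurable_continuous[OF z] p by (simp add: Lp_space_def N_def)
  have "enn2real N powr (1 / p) \<le> (B powr p) powr (1 / p)"
    using N p by (intro powr_mono2 enn2real_leI) auto
  also have "\<dots> = B" using p B by (simp add: powr_powr)
  finally show "Lp_norm (ennreal p) z \<le> B" using p by (simp add: Lp_norm_def N_def)
qed

lemma Linf_intro:
  fixes z :: "real \<Rightarrow> 'a::banach"
  assumes z: "continuous_on {0..} z" and B: "\<And>t. 0 \<le> t \<Longrightarrow> norm (z t) \<le> B"
  shows "z \<in> Lp_space \<infinity>" and "Lp_norm \<infinity> z \<le> B"
proof -
  have B0: "0 \<le> B" using B[of 0] norm_ge_zero[of "z 0"] by linarith
  have "continuous_on {0..} (\<lambda>t. norm (z t))" by (intro continuous_intros z)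
  then have "(\<lambda>t. norm (z t)) \<in> borel_measurable (lebesgue_on {0..})"
    by (intro continuous_imp_measurable_on_sets_lebesgue) auto
  then have "esssup (lebesgue_on {0..}) (\<lambda>t. ennreal (norm (z t))) \<le> ennreal B"
    by (intro esssup_I measurable_compose[OF _ measurable_ennreal])
      (auto simp: space_restrict_space intro!: AE_I2 ennreal_leI B)
  then show "z \<in> Lp_space \<infinity>" and "Lp_norm \<infinity> z \<le> B"
    using bochner_measurable_continuous[OF z] B0
    by (auto simp: Lp_space_def Lp_norm_def intro: enn2real_leI order.strict_trans1)
qed

lemma Lp_finite_dest:
  fixes r :: "real \<Rightarrow> 'a::banach"
  assumes r: "r \<in> Lp_space (ennreal q)" "Lp_norm (ennreal q) r \<le> \<epsilon>" and q: "1 \<le> q"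
  shows "(\<integral>\<^sup>+t. ennreal ((indicator {0..} t * norm (r t)) powr q) \<partial>lborel) \<le> ennreal (\<epsilon> powr q)"
proof -
  define N where "N = (\<integral>\<^sup>+t. ennreal (norm (r t) powr q) \<partial>lebesgue_on {0..})"
  have "(\<integral>\<^sup>+t. ennreal ((indicator {0..} t * norm (r t)) powr q) \<partial>lborel) = N"
    unfolding N_def nn_integral_lebesgue_on_halfline
    using q by (intro nn_integral_cong) (simp split: split_indicator)
  moreover have "N < \<infinity>" and le: "enn2real N powr (1 / q) \<le> \<epsilon>"
    using r q by (simp_all add: Lp_space_def Lp_norm_def N_def)
  moreover have "enn2real N \<le> \<epsilon> powr q"
    using powr_mono2[OF _ _ le, of q] q by (simp add: powr_powr)
  ultimately show ?thesis by (metis ennreal_enn2real ennreal_leI infinity_ennreal_def)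
qed

lemma Linf_dest:
  fixes r :: "real \<Rightarrow> 'a::banach"
  assumes r: "r \<in> Lp_space \<infinity>" "Lp_norm \<infinity> r \<le> \<epsilon>"
  shows "AE t in lborel. indicator {0..} t * norm (r t) \<le> \<epsilon>"
proof -
  define e where "e = esssup (lebesgue_on {0..}) (\<lambda>t. ennreal (norm (r t)))"
  have "e < \<infinity>" "enn2real e \<le> \<epsilon>" using r by (simp_all add: Lp_space_def Lp_norm_def e_def)
  then have e: "e \<le> ennreal \<epsilon>" and \<epsilon>: "0 \<le> \<epsilon>"
    by (metis ennreal_enn2real ennreal_leI infinity_ennreal_def, metis enn2real_nonneg order_trans)
  have "AE t in lebesgue_on {0..}. ennreal (norm (r t)) \<le> e" unfolding e_def by (rule esssup_AE)
  then have "AE t in lebesgue. t \<in> {0..} \<longrightarrow> ennreal (norm (r t)) \<le> e"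
    by (subst (asm) AE_restrict_space_iff) auto
  then have "AE t in lborel. t \<in> {0..} \<longrightarrow> ennreal (norm (r t)) \<le> e" by (simp add: AE_completion_iff)
  then show ?thesis
  proof eventually_elim
    case (elim t)
    show ?case
    proof (cases "0 \<le> t")
      case True
      then have "ennreal (norm (r t)) \<le> ennreal \<epsilon>" using elim e by (auto intro: order_trans)
      then show ?thesis using True \<epsilon> by simp
    qed (simp add: \<epsilon>)
  qed
qed

lemma exp_potential_le_of_bound:
  assumes \<mu>: "0 < \<mu>" and \<epsilon>: "0 \<le> \<epsilon>" and g: "AE s in lborel. g s \<le> \<epsilon>"
  shows "exp_potential \<mu> g t \<le> ennreal (max 1 (2 / \<mu>) * \<epsilon>)"
proof -
  have "exp_potential \<mu> g t \<le> (\<integral>\<^sup>+s. ennreal \<epsilon> * ennreal (exp (- \<mu> * \<bar>t - s\<bar>)) \<partial>lborel)"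
    unfolding exp_potential_def
  proof (rule nn_integral_mono_AE, use g in eventually_elim)
    case (elim s)
    then show ?case using \<epsilon> by (simp add: mult.commute mult_left_mono flip: ennreal_mult)
  qed
  also have "\<dots> \<le> ennreal \<epsilon> * ennreal (2 / \<mu>)"
    using nn_integral_exp_kernel_le[OF \<mu>] by (simp add: nn_integral_cmult mult_left_mono)
  also have "\<dots> \<le> ennreal (max 1 (2 / \<mu>) * \<epsilon>)"
    using \<mu> \<epsilon> mult_left_mono[of "2 / \<mu>" "max 1 (2 / \<mu>)" \<epsilon>]
    by (simp add: mult.commute flip: ennreal_mult)
  finally show ?thesis .
qed

lemma ennreal_exponent_cases:
  assumes "1 \<le> (q::ennreal)"
  obtains "q = \<infinity>" | q' where "q = ennreal q'" "1 \<le> q'"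
  using assms by (cases q) (auto simp flip: ennreal_1)

lemma exp_potential_sup_le_Lp_norm:
  fixes r :: "real \<Rightarrow> 'a::banach"
  assumes r: "continuous_on {0..} r" "r \<in> Lp_space q" "Lp_norm q r \<le> \<epsilon>"
    and \<epsilon>: "0 < \<epsilon>" and q: "1 \<le> q" and \<mu>: "0 < \<mu>"
  shows "exp_potential \<mu> (\<lambda>s. indicator {0..} s * norm (r s)) t \<le> ennreal (max 1 (2 / \<mu>) * \<epsilon>)"
  using q
proof (cases q rule: ennreal_exponent_cases)
  case 1
  then show ?thesis using exp_potential_le_of_bound[OF \<mu> _ Linf_dest[of r]] r \<epsilon> by simp
next
  case (2 q')
  then show ?thesis
    using Lp_finite_dest[of r q' \<epsilon>] r \<epsilon> \<mu>
    by (intro exp_potential_le_of_powr_integral[of _ _ q'] borel_measurable_halfline_extension) auto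
qed

text \<open>
  Young's inequality \<open>\<parallel>k * |r|\<parallel>\<^sub>p \<le> max(1, 2 / \<mu>) \<parallel>r\<parallel>\<^sub>q\<close> for the exponential kernel \<open>k\<close> and
  \<open>q \<le> p\<close>, finite or not. The norm of \<open>r\<close> enters through a bound \<open>\<epsilon> > 0\<close>, as in the definition of
  Hyers-Ulam stability.
\<close>
lemma Lp_norm_le_of_exp_potential_bound:
  fixes r z :: "real \<Rightarrow> 'a::banach"
  assumes r: "continuous_on {0..} r" "r \<in> Lp_space q" "Lp_norm q r \<le> \<epsilon>"
    and \<epsilon>: "0 < \<epsilon>" and q: "1 \<le> q" "q \<le> p" and \<mu>: "0 < \<mu>"
    and z: "continuous_on {0..} z" and C: "0 \<le> C"
    and bd: "\<And>t. 0 \<le> t \<Longrightarrow>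
      norm (z t) \<le> C * enn2real (exp_potential \<mu> (\<lambda>s. indicator {0..} s * norm (r s)) t)"
  shows "z \<in> Lp_space p" and "Lp_norm p z \<le> C * max 1 (2 / \<mu>) * \<epsilon>"
proof -
  define g where "g s = indicator {0..} s * norm (r s)" for s
  define \<Psi> where "\<Psi> t = enn2real (exp_potential \<mu> g t)" for t
  define M where "M = max 1 (2 / \<mu>)"
  have M: "1 \<le> M" by (simp add: M_def)
  have g[measurable]: "g \<in> borel_measurable borel"
    unfolding g_def[abs_def] by (rule borel_measurable_halfline_extension[OF r(1)])
  have bd: "norm (z t) \<le> C * \<Psi> t" if "0 \<le> t" for t using bd[OF that] by (simp add: \<Psi>_def g_def[abs_def])
  from order_trans[OF q] have "z \<in> Lp_space p \<and> Lp_norm p z \<le> C * M * \<epsilon>"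
  proof (cases p rule: ennreal_exponent_cases)
    case 1
    have "\<Psi> t \<le> M * \<epsilon>" for t
      unfolding \<Psi>_def M_def g_def using exp_potential_sup_le_Lp_norm[OF r \<epsilon> q(1) \<mu>] \<epsilon> by (intro enn2real_leI) auto
    then have "norm (z t) \<le> C * M * \<epsilon>" if "0 \<le> t" for t
      using bd[OF that] C mult_left_mono[of "\<Psi> t" "M * \<epsilon>" C] by (simp add: mult.assoc)
    then show ?thesis unfolding 1 by (intro conjI Linf_intro[OF z])
  next
    case (2 p')
    then have "q < \<infinity>" using order.strict_trans1[OF q(2)] by simp
    then obtain q' where q': "q = ennreal q'" "1 \<le> q'"
      using ennreal_exponent_cases[OF q(1)] by (metis less_irrefl)
    then have "q' \<le> p'" using q(2) 2 by simp
    have "(\<integral>\<^sup>+t. ennreal (indicator {0..} t * norm (z t) powr p') \<partial>lborel)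
        \<le> (\<integral>\<^sup>+t. ennreal (C powr p') * ennreal (\<Psi> t powr p') \<partial>lborel)"
    proof (intro nn_integral_mono)
      fix t
      have "norm (z t) powr p' \<le> C powr p' * \<Psi> t powr p'" if "0 \<le> t"
        using powr_mono2[OF _ _ bd[OF that], of p'] 2 C by (simp add: powr_mult \<Psi>_def)
      then show "ennreal (indicator {0..} t * norm (z t) powr p') \<le> ennreal (C powr p') * ennreal (\<Psi> t powr p')"
        by (auto simp: indicator_def ennreal_leI simp flip: ennreal_mult)
    qed
    also have "\<dots> = ennreal (C powr p') * (\<integral>\<^sup>+t. ennreal (\<Psi> t powr p') \<partial>lborel)"
      unfolding \<Psi>_def exp_potential_def by (intro nn_integral_cmult) measurable
    also have "\<dots> \<le> ennreal (C powr p') * ennreal ((M * \<epsilon>) powr p')"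
      unfolding \<Psi>_def M_def using \<mu> q' \<open>q' \<le> p'\<close> \<epsilon> r
      by (intro mult_left_mono nn_integral_exp_potential_powr_le[of _ _ q'] g)
        (auto simp: g_def intro!: Lp_finite_dest)
    also have "\<dots> = ennreal ((C * M * \<epsilon>) powr p')"
      using C M \<epsilon> by (simp add: powr_mult mult.assoc flip: ennreal_mult)
    finally show ?thesis unfolding 2(1) using C M \<epsilon> by (intro conjI Lp_finite_intro[OF z 2(2)]) auto
  qed
  then show "z \<in> Lp_space p" and "Lp_norm p z \<le> C * max 1 (2 / \<mu>) * \<epsilon>" by (simp_all add: M_def)
qed

lemma integral_le_of_nn_integral_le:
  fixes k m :: "real \<Rightarrow> real"
  assumes k: "continuous_on {0..b} k" and bd: "\<And>s. 0 \<le> s \<Longrightarrow> 0 \<le> k s \<and> k s \<le> m s"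
    and m: "(\<integral>\<^sup>+s. ennreal (m s) \<partial>lborel) \<le> ennreal C" and C: "0 \<le> C"
  shows "integral {0..b} k \<le> C"
proof -
  have "(k has_integral integral {0..b} k) {0..b}"
    using k by (intro integrable_integral integrable_continuous_real)
  then have "ennreal (integral {0..b} k) = (\<integral>\<^sup>+s. ennreal (k s) * indicator {0..b} s \<partial>lborel)"
    using bd by (intro nn_integral_has_integral_lebesgue'[symmetric]) auto
  also have "\<dots> \<le> (\<integral>\<^sup>+s. ennreal (m s) \<partial>lborel)"
    using bd by (intro nn_integral_mono) (auto simp: indicator_def ennreal_leI)
  also note m
  finally show ?thesis using C by simp
qed

lemma integral_exp_kernel_le:
  fixes \<mu> :: real
  assumes "0 < \<mu>"
  shows "integral {0..b} (\<lambda>s. exp (- \<mu> * \<bar>t - s\<bar>)) \<le> 2 / \<mu>"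
  using assms nn_integral_exp_kernel_le[OF assms, of t]
  by (intro integral_le_of_nn_integral_le continuous_intros) auto

lemma integral_le_exp_potential:
  assumes h: "continuous_on {0..} h" and \<mu>: "\<mu> \<le> l"
    and fin: "exp_potential \<mu> (\<lambda>s. indicator {0..} s * norm (h s)) t < \<infinity>"
  shows "integral {0..b} (\<lambda>s. exp (- l * \<bar>t - s\<bar>) * norm (h s))
    \<le> enn2real (exp_potential \<mu> (\<lambda>s. indicator {0..} s * norm (h s)) t)"
proof (rule integral_le_of_nn_integral_le)
  show "continuous_on {0..b} (\<lambda>s. exp (- l * \<bar>t - s\<bar>) * norm (h s))"
    by (intro continuous_intros continuous_on_subset[OF h]) auto
  show "0 \<le> exp (- l * \<bar>t - s\<bar>) * norm (h s) \<and> exp (- l * \<bar>t - s\<bar>) * norm (h s)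
      \<le> exp (- \<mu> * \<bar>t - s\<bar>) * (indicator {0..} s * norm (h s))" if "0 \<le> s" for s
    using \<mu> that by (auto intro!: mult_right_mono)
qed (use fin in \<open>simp_all add: exp_potential_def\<close>)

section \<open>Lipschitz perturbations of a dichotomy\<close>

text \<open>
  Exchanging \<open>t\<close> and \<open>u\<close> bounds \<open>\<psi>(u)\<close> from below as well, by \<open>exp(-\<mu>|t - u|) \<psi>(t)\<close>.
\<close>
lemma continuous_of_slow_variation:
  fixes \<psi> :: "real \<Rightarrow> real"
  assumes slow: "\<And>t u. t \<in> S \<Longrightarrow> u \<in> S \<Longrightarrow> \<psi> u \<le> exp (\<mu> * \<bar>t - u\<bar>) * \<psi> t"
  shows "continuous_on S \<psi>"
  unfolding continuous_on_def
proof
  fix t assume t: "t \<in> S"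
  have S: "\<forall>\<^sub>F u in at t within S. u \<in> S" by (simp add: eventually_at_filter)
  show "(\<psi> \<longlongrightarrow> \<psi> t) (at t within S)"
  proof (rule tendsto_sandwich)
    show "\<forall>\<^sub>F u in at t within S. exp (- \<mu> * \<bar>t - u\<bar>) * \<psi> t \<le> \<psi> u"
      using S by eventually_elim
        (use slow[OF _ t] in \<open>simp add: exp_minus abs_minus_commute field_simps\<close>)
    show "\<forall>\<^sub>F u in at t within S. \<psi> u \<le> exp (\<mu> * \<bar>t - u\<bar>) * \<psi> t"
      using S by eventually_elim (rule slow[OF t])
    have "((\<lambda>u. exp (- \<mu> * \<bar>t - u\<bar>) * \<psi> t) \<longlongrightarrow> exp (- \<mu> * \<bar>t - t\<bar>) * \<psi> t) (at t within S)"
      "((\<lambda>u. exp (\<mu> * \<bar>t - u\<bar>) * \<psi> t) \<longlongrightarrow> exp (\<mu> * \<bar>t - t\<bar>) * \<psi> t) (at t within S)"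
      by (intro tendsto_intros)+
    then show "((\<lambda>u. exp (- \<mu> * \<bar>t - u\<bar>) * \<psi> t) \<longlongrightarrow> \<psi> t) (at t within S)"
      "((\<lambda>u. exp (\<mu> * \<bar>t - u\<bar>) * \<psi> t) \<longlongrightarrow> \<psi> t) (at t within S)" by simp_all
  qed
qed

context dichotomous_flow begin

lemma admissible_diff:
  assumes "admissible h" and "admissible k"
  shows "admissible (\<lambda>s. h s - k s)"
proof -
  obtain C1 C2 where h: "continuous_on {0..} h" and k: "continuous_on {0..} k"
    and C1: "\<And>b. 0 \<le> b \<Longrightarrow> integral {0..b} (\<lambda>s. exp (- l * s) * norm (h s)) \<le> C1"
    and C2: "\<And>b. 0 \<le> b \<Longrightarrow> integral {0..b} (\<lambda>s. exp (- l * s) * norm (k s)) \<le> C2"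
    using assms unfolding admissible_def by blast
  have "integral {0..b} (\<lambda>s. exp (- l * s) * norm (h s - k s)) \<le> C1 + C2" if "0 \<le> b" for b
  proof -
    have "integral {0..b} (\<lambda>s. exp (- l * s) * norm (h s - k s))
        \<le> integral {0..b} (\<lambda>s. exp (- l * s) * norm (h s) + exp (- l * s) * norm (k s))"
      by (intro integral_le integrable_halfline continuous_intros h k order.refl)
        (auto simp flip: distrib_left intro!: mult_left_mono norm_triangle_ineq4)
    also have "\<dots> = integral {0..b} (\<lambda>s. exp (- l * s) * norm (h s)) + integral {0..b} (\<lambda>s. exp (- l * s) * norm (k s))"
      by (intro integral_add integrable_halfline continuous_intros h k order.refl)
    finally show ?thesis using C1[OF that] C2[OF that] by linarith
  qed
  then show ?thesis unfolding admissible_def by (auto intro!: continuous_intros h k)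
qed

lemma admissible_intro:
  assumes "continuous_on {0..} h"
    and "\<And>b. integral {0..b} (\<lambda>s. exp (- l * \<bar>0 - s\<bar>) * norm (h s)) \<le> C"
  shows "admissible h"
proof -
  have "integral {0..b} (\<lambda>s. exp (- l * s) * norm (h s))
      = integral {0..b} (\<lambda>s. exp (- l * \<bar>0 - s\<bar>) * norm (h s))" for b
    by (intro integral_cong) simp
  then show ?thesis unfolding admissible_def using assms by auto
qed

text \<open>
  The core of the argument, for an arbitrary slowly varying majorant \<open>\<psi>\<close> of the Green integral of \<open>r\<close>.
  If \<open>|h| \<le> a \<psi>\<close>, then \<open>exp(-l|t - s|) |h(s)| \<le> a \<psi>(t) exp(-(l - \<mu>)|t - s|)\<close>: slow variation
  pulls the weight out of the integral at the price of lowering the rate from \<open>l\<close> to \<open>l - \<mu>\<close>. So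
  the Green operator is bounded by \<open>2 D / (l - \<mu>)\<close> in units of \<open>\<psi>\<close>.
\<close>
lemma perturbed_equation_solution:
  fixes F :: "real \<Rightarrow> 'a \<Rightarrow> 'a" and r :: "real \<Rightarrow> 'a"
  assumes F_cont: "\<And>w. continuous_on {0..} w \<Longrightarrow> continuous_on {0..} (\<lambda>t. F t (w t))"
    and F_Lip: "\<And>t u v. 0 \<le> t \<Longrightarrow> norm (F t u - F t v) \<le> c * norm (u - v)"
    and F_0: "\<And>t. 0 \<le> t \<Longrightarrow> F t 0 = 0" and c: "0 \<le> c"
    and r: "continuous_on {0..} r"
    and slow: "\<And>t u. 0 \<le> t \<Longrightarrow> 0 \<le> u \<Longrightarrow> \<psi> u \<le> exp (\<mu> * \<bar>t - u\<bar>) * \<psi> t"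
    and \<psi>_nonneg: "\<And>t. 0 \<le> t \<Longrightarrow> 0 \<le> \<psi> t"
    and r_le: "\<And>t b. 0 \<le> t \<Longrightarrow> integral {0..b} (\<lambda>s. exp (- l * \<bar>t - s\<bar>) * norm (r s)) \<le> \<psi> t"
    and \<mu>: "\<mu> < l" and \<rho>: "2 * D * c / (l - \<mu>) < 1"
  obtains w where "\<And>t. 0 \<le> t \<Longrightarrow>
      (w has_vector_derivative A t (w t) + F t (w t) - r t) (at t within {0..})"
    and "\<And>t. 0 \<le> t \<Longrightarrow> norm (w t) \<le> D / (1 - 2 * D * c / (l - \<mu>)) * \<psi> t"
proof -
  define \<rho> where "\<rho> = 2 * D * c / (l - \<mu>)"
  have \<rho>01: "0 \<le> \<rho>" "\<rho> < 1" using \<rho> D c \<mu> by (auto simp: \<rho>_def)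
  have \<psi>: "continuous_on {0..} \<psi>" by (rule continuous_of_slow_variation[of _ _ \<mu>]) (use slow in auto)
  have weighted: "integral {0..b} (\<lambda>s. exp (- l * \<bar>t - s\<bar>) * norm (h s)) \<le> a * \<psi> t * (2 / (l - \<mu>))"
    if h: "continuous_on {0..} h" "\<And>s. 0 \<le> s \<Longrightarrow> norm (h s) \<le> a * \<psi> s" and a: "0 \<le> a" and t: "0 \<le> t"
    for h :: "real \<Rightarrow> 'a" and a t b
  proof -
    have "integral {0..b} (\<lambda>s. exp (- l * \<bar>t - s\<bar>) * norm (h s))
        \<le> integral {0..b} (\<lambda>s. a * \<psi> t * exp (- (l - \<mu>) * \<bar>t - s\<bar>))"
    proof (rule integral_le)
      fix s assume "s \<in> {0..b}"
      then have s: "0 \<le> s" by simp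
      have "norm (h s) \<le> a * (exp (\<mu> * \<bar>t - s\<bar>) * \<psi> t)"
        using h(2)[OF s] mult_left_mono[OF slow[OF t s] a] by linarith
      then have "exp (- l * \<bar>t - s\<bar>) * norm (h s) \<le> exp (- l * \<bar>t - s\<bar>) * (a * (exp (\<mu> * \<bar>t - s\<bar>) * \<psi> t))"
        by (intro mult_left_mono) auto
      also have "\<dots> = a * \<psi> t * (exp (- l * \<bar>t - s\<bar>) * exp (\<mu> * \<bar>t - s\<bar>))" by (simp only: mult_ac)
      also have "\<dots> = a * \<psi> t * exp (- (l - \<mu>) * \<bar>t - s\<bar>)"
        by (simp add: algebra_simps flip: exp_add)
      finally show "exp (- l * \<bar>t - s\<bar>) * norm (h s) \<le> a * \<psi> t * exp (- (l - \<mu>) * \<bar>t - s\<bar>)" .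
    qed (intro integrable_halfline continuous_intros h order.refl)+
    also have "\<dots> = a * \<psi> t * integral {0..b} (\<lambda>s. exp (- (l - \<mu>) * \<bar>t - s\<bar>))" by simp
    also have "\<dots> \<le> a * \<psi> t * (2 / (l - \<mu>))"
      using \<mu> a \<psi>_nonneg[OF t] by (intro mult_left_mono integral_exp_kernel_le) auto
    finally show ?thesis .
  qed
  have r_adm: "admissible r" by (rule admissible_intro[OF r r_le]) simp
  have F_adm: "admissible (\<lambda>s. F s (w s) - r s)"
    if w: "continuous_on {0..} w" "\<And>t. 0 \<le> t \<Longrightarrow> norm (w t) \<le> C * \<psi> t" for w C
  proof (rule admissible_diff[OF _ r_adm])
    have "norm (F s (w s)) \<le> (c * max 0 C) * \<psi> s" if s: "0 \<le> s" for s
    proof -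
      have "norm (F s (w s)) \<le> c * norm (w s)" using F_Lip[OF s, of "w s" 0] F_0[OF s] by simp
      \<comment> \<open>\<open>C\<close> is arbitrary, and may be negative if \<open>\<psi>\<close> vanishes.\<close>
      also have "norm (w s) \<le> max 0 C * \<psi> s"
        using w(2)[OF s] \<psi>_nonneg[OF s] by (smt (verit) mult_right_mono)
      finally show ?thesis using c by (simp add: mult.assoc mult_left_mono)
    qed
    then show "admissible (\<lambda>s. F s (w s))"
      using c by (intro admissible_intro[OF F_cont[OF w(1)] weighted[OF F_cont[OF w(1)], of "c * max 0 C"]]) auto
  qed
  define \<Phi> where "\<Phi> w = green (\<lambda>s. F s (w s) - r s)" for w
  have deriv: "(\<Phi> w has_vector_derivative A t (\<Phi> w t) + (F t (w t) - r t)) (at t within {0..})"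
    if "continuous_on {0..} w" "0 \<le> t" for w t
    unfolding \<Phi>_def by (intro green_has_vector_derivative continuous_intros F_cont r that)
  obtain w where w: "continuous_on {0..} w" "\<And>t. 0 \<le> t \<Longrightarrow> norm (w t) \<le> D / (1 - \<rho>) * \<psi> t"
    "\<And>t. 0 \<le> t \<Longrightarrow> \<Phi> w t = w t"
  proof (rule weighted_contraction_fixpoint[OF \<psi> \<psi>_nonneg \<rho>01, of D \<Phi>])
    show "continuous_on {0..} (\<Phi> w)" if "continuous_on {0..} w" for w
      using deriv[OF that] by (rule continuous_on_halfline_of_derivative)
    show "norm (\<Phi> (\<lambda>_. 0) t) \<le> D * \<psi> t" if t: "0 \<le> t" for t
      unfolding \<Phi>_def
    proof (rule norm_green_le[OF F_adm[of _ 0] t])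
      fix b
      have "integral {0..b} (\<lambda>s. exp (- l * \<bar>t - s\<bar>) * norm (F s 0 - r s))
          = integral {0..b} (\<lambda>s. exp (- l * \<bar>t - s\<bar>) * norm (r s))"
        by (intro integral_cong) (simp add: F_0)
      then show "integral {0..b} (\<lambda>s. exp (- l * \<bar>t - s\<bar>) * norm (F s 0 - r s)) \<le> \<psi> t"
        using r_le[OF t] by simp
    qed auto
    fix u v :: "real \<Rightarrow> 'a" and C d t
    assume u: "continuous_on {0..} u" "\<And>t. 0 \<le> t \<Longrightarrow> norm (u t) \<le> C * \<psi> t"
      and v: "continuous_on {0..} v" "\<And>t. 0 \<le> t \<Longrightarrow> norm (v t) \<le> C * \<psi> t"
      and d: "0 \<le> d" "\<And>t. 0 \<le> t \<Longrightarrow> norm (u t - v t) \<le> d * \<psi> t" and t: "(0::real) \<le> t"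
    have "\<Phi> u t - \<Phi> v t = green (\<lambda>s. (F s (u s) - r s) - (F s (v s) - r s)) t"
      unfolding \<Phi>_def by (intro green_diff F_adm[OF u] F_adm[OF v] t)
    also have "norm \<dots> \<le> D * (c * d * \<psi> t * (2 / (l - \<mu>)))"
    proof (rule norm_green_le[OF admissible_diff[OF F_adm[OF u] F_adm[OF v]] t weighted])
      fix s :: real assume s: "0 \<le> s"
      have "norm (F s (u s) - F s (v s)) \<le> c * norm (u s - v s)" by (rule F_Lip[OF s])
      also have "\<dots> \<le> c * (d * \<psi> s)" using d(2)[OF s] c by (rule mult_left_mono)
      finally show "norm (F s (u s) - r s - (F s (v s) - r s)) \<le> c * d * \<psi> s" by (simp add: mult.assoc)
    qed (use c d t in \<open>auto intro!: continuous_intros F_cont r u v\<close>)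
    also have "\<dots> = \<rho> * d * \<psi> t" by (simp add: \<rho>_def)
    finally show "norm (\<Phi> u t - \<Phi> v t) \<le> \<rho> * d * \<psi> t" .
  qed (use D in auto)
  show thesis
  proof (rule that[of w])
    fix t :: real assume t: "0 \<le> t"
    have "(w has_vector_derivative A t (\<Phi> w t) + (F t (w t) - r t)) (at t within {0..})"
      by (rule has_vector_derivative_transform[OF _ _ deriv[OF w(1) t]]) (use t w(3) in auto)
    then show "(w has_vector_derivative A t (w t) + F t (w t) - r t) (at t within {0..})"
      using w(3)[OF t] by (simp add: add_diff_eq)
    show "norm (w t) \<le> D / (1 - 2 * D * c / (l - \<mu>)) * \<psi> t" using w(2)[OF t] by (simp add: \<rho>_def)
  qed
qed

end

section \<open>Hyers-Ulam stability\<close>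

theorem theorem1:
  fixes A :: "real \<Rightarrow> 'a::banach \<Rightarrow>\<^sub>L 'a"
    and f :: "real \<Rightarrow> 'a \<Rightarrow> 'a"
    and p q :: ennreal
    and D l c :: real
  assumes "continuous_on {0..} A"
    and "continuous_on ({0..} \<times> UNIV) (\<lambda>(t, v). f t v)"
    and "1 \<le> q" and "q \<le> p"
    and "exponential_dichotomy A D l"
    and "0 \<le> c" and "c < l / (2 * D)"
    and "\<And>t v1 v2. 0 \<le> t \<Longrightarrow> norm (f t v1 - f t v2) \<le> c * norm (v1 - v2)"
  shows "hyers_ulam_stable p q A f"
proof -
  note A = assms(1) and q = assms(3,4) and c = assms(6) and Lip = assms(8)
  obtain U V P where "dichotomous_flow A U V P D l"
    using dichotomous_flow_of_exponential_dichotomy[OF assms(1,5)] .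
  then interpret dichotomous_flow A U V P D l .
  have f_comp: "continuous_on {0..} (\<lambda>t. f t (w t))" if "continuous_on {0..} w" for w
  proof -
    have "continuous_on {0..} (\<lambda>t. (t, w t))" by (intro continuous_intros that)
    from continuous_on_compose2[OF assms(2) this] show ?thesis by auto
  qed
  \<comment> \<open>Any rate with \<open>2 D c < l - \<mu>\<close> makes the contraction factor less than \<open>1\<close>.\<close>
  define \<mu> where "\<mu> = (l - 2 * D * c) / 2"
  have Dc: "2 * D * c < l" using assms(7) D by (simp add: field_simps)
  moreover have "0 \<le> 2 * D * c" using D c by simp
  ultimately have \<mu>: "0 < \<mu>" "\<mu> < l" using l by (simp_all add: \<mu>_def)
  define \<rho> where "\<rho> = 2 * D * c / (l - \<mu>)"
  have \<rho>: "\<rho> < 1" using Dc \<mu> by (simp add: \<rho>_def \<mu>_def field_simps)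
  define L where "L = D / (1 - \<rho>) * max 1 (2 / \<mu>)"
  have "0 < L" using D \<rho> by (simp add: L_def)
  moreover have "\<exists>x. solves (\<lambda>t v. A t v + f t v) x \<and> (\<lambda>t. x t - y t) \<in> Lp_space p
      \<and> Lp_norm p (\<lambda>t. x t - y t) \<le> L * \<epsilon>"
    if \<epsilon>: "0 < \<epsilon>" and y: "\<And>t. 0 \<le> t \<Longrightarrow> (y has_vector_derivative y' t) (at t within {0..})"
      and y': "continuous_on {0..} y'"
      and res: "(\<lambda>t. y' t - A t (y t) - f t (y t)) \<in> Lp_space q"
        "Lp_norm q (\<lambda>t. y' t - A t (y t) - f t (y t)) \<le> \<epsilon>" for \<epsilon> y y'
  proof -
    define r where "r t = y' t - A t (y t) - f t (y t)" for t
    have y_cont: "continuous_on {0..} y" using y by (rule continuous_on_halfline_of_derivative)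
    have r: "continuous_on {0..} r" unfolding r_def[abs_def]
      by (intro continuous_intros y' A y_cont f_comp)
    have rq: "r \<in> Lp_space q" "Lp_norm q r \<le> \<epsilon>" using res by (simp_all add: r_def[abs_def])
    define g where "g s = indicator {0..} s * norm (r s)" for s
    define \<psi> where "\<psi> t = enn2real (exp_potential \<mu> g t)" for t
    have fin: "exp_potential \<mu> g t < \<infinity>" for t
      using exp_potential_sup_le_Lp_norm[OF r rq \<epsilon> q(1) \<mu>(1), of t]
      unfolding g_def[abs_def] by (metis ennreal_less_top infinity_ennreal_def order.strict_trans1)
    have slow: "\<psi> u \<le> exp (\<mu> * \<bar>t - u\<bar>) * \<psi> t" for t u
    proof -
      have "exp_potential \<mu> g u \<le> ennreal (exp (\<mu> * \<bar>t - u\<bar>)) * exp_potential \<mu> g t"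
        using \<mu> borel_measurable_halfline_extension[OF r]
        by (intro exp_potential_slow_variation) (auto simp: g_def[abs_def])
      then have "\<psi> u \<le> enn2real (ennreal (exp (\<mu> * \<bar>t - u\<bar>)) * exp_potential \<mu> g t)"
        unfolding \<psi>_def using fin[of t] by (intro enn2real_mono) (auto simp: ennreal_mult_less_top)
      then show ?thesis by (simp add: \<psi>_def enn2real_mult)
    qed
    define F where "F t v = f t (y t + v) - f t (y t)" for t v
    obtain w where w: "\<And>t. 0 \<le> t \<Longrightarrow>
        (w has_vector_derivative A t (w t) + F t (w t) - r t) (at t within {0..})"
      and w_le: "\<And>t. 0 \<le> t \<Longrightarrow> norm (w t) \<le> D / (1 - \<rho>) * \<psi> t"
    proof (rule perturbed_equation_solution[of F c r \<psi> \<mu>])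
      show "continuous_on {0..} (\<lambda>t. F t (w t))" if "continuous_on {0..} w" for w
        unfolding F_def using that by (intro continuous_intros f_comp y_cont)
      show "norm (F t u - F t v) \<le> c * norm (u - v)" if "0 \<le> t" for t u v
        using Lip[OF that, of "y t + u" "y t + v"] by (simp add: F_def)
      show "integral {0..b} (\<lambda>s. exp (- l * \<bar>t - s\<bar>) * norm (r s)) \<le> \<psi> t" for t b
        using integral_le_exp_potential[OF r, of \<mu> l t b] \<mu> fin[of t]
        by (simp add: \<psi>_def g_def[abs_def])
    qed (use c r slow \<mu> \<rho> in \<open>auto simp: F_def \<psi>_def \<rho>_def\<close>)
    have w_cont: "continuous_on {0..} w" using w by (rule continuous_on_halfline_of_derivative)
    define x where "x t = y t + w t" for t
    have "(x has_vector_derivative A t (x t) + f t (x t)) (at t within {0..})" if t: "0 \<le> t" for t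
    proof -
      have "(x has_vector_derivative y' t + (A t (w t) + F t (w t) - r t)) (at t within {0..})"
        unfolding x_def[abs_def] by (intro has_vector_derivative_add y w t)
      then show ?thesis by (simp add: r_def F_def x_def blinfun.add_right algebra_simps)
    qed
    moreover have "w \<in> Lp_space p" "Lp_norm p w \<le> D / (1 - \<rho>) * max 1 (2 / \<mu>) * \<epsilon>"
      using Lp_norm_le_of_exp_potential_bound[OF r rq \<epsilon> q \<mu>(1) w_cont, of "D / (1 - \<rho>)"] w_le D \<rho>
      by (simp_all add: \<psi>_def g_def[abs_def])
    ultimately show ?thesis
      by (intro exI[of _ x]) (simp add: solves_def x_def[abs_def] L_def)
  qed
  ultimately show ?thesis unfolding hyers_ulam_stable_def by blast
qed

end
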